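(* Let $C_1,C_2\subset\mathbb{P}^3$ be smooth complex conics spanning different planes $\Pi_1$ and $\Pi_2$. If $C_1\cap C_2=\emptyset$ and neither conic is tangent to the plane of the other, then the edge surface $\mathcal{E}\subset\mathbb{P}^3$ of $C_1,C_2$ has degree eight.
   Context: Here $\mathbb{P}^3=\mathbb{CP}^3$. A stationary bisecant of $C_1,C_2$ is a line $\overline{p,q}$ spanned by points $p\in C_1$ and $q\in C_2$ with $p\neq q$ such that the tangent lines $T_pC_1$ and $T_qC_2$ meet. The edge surface $\mathcal{E}$ is the Zariski closure in $\mathbb{P}^3$ of the union of all stationary bisecants. *)

theory Defs
  imports "HOL-Analysis.Analysis" "HOL-Library.Poly_Mapping"
begin

section \<open>Polynomials in four variables over the complex numbers\<close>

text \<open>Exponent vectors are finitely supported maps from the four-element index type to the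
  naturals, so the ring structure, and in particular divisibility, is that of
  \<^theory>\<open>HOL-Library.Poly_Mapping\<close>.\<close>

type_synonym poly4 = "(4 \<Rightarrow>\<^sub>0 nat) \<Rightarrow>\<^sub>0 complex"

definition eval4 :: "poly4 \<Rightarrow> complex^4 \<Rightarrow> complex" where
  "eval4 f x = (\<Sum>m\<in>Poly_Mapping.keys f.
      Poly_Mapping.lookup f m * (\<Prod>i\<in>UNIV. (x $ i) ^ Poly_Mapping.lookup m i))"

text \<open>The zero polynomial is homogeneous of every degree.\<close>

definition homogeneous4 :: "nat \<Rightarrow> poly4 \<Rightarrow> bool" where
  "homogeneous4 d f \<longleftrightarrow>
     (\<forall>m\<in>Poly_Mapping.keys f. (\<Sum>i\<in>UNIV. Poly_Mapping.lookup m i) = d)"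

text \<open>The value at \<open>v\<close> of the differential of \<open>f\<close> at \<open>x\<close>.\<close>

definition differential4 :: "poly4 \<Rightarrow> complex^4 \<Rightarrow> complex^4 \<Rightarrow> complex" where
  "differential4 f x v = deriv (\<lambda>t. eval4 f (x + t *s v)) 0"


section \<open>Complex projective three-space\<close>

text \<open>A point of projective space is a one-dimensional complex subspace of the
  four-dimensional coordinate space; all subsets of projective space are sets of such
  subspaces.\<close>

type_synonym point = "(complex^4) set"

definition P3 :: "point set" where
  "P3 = {P. vec.subspace P \<and> vec.dim P = 1}"

definition projectivization :: "(complex^4) set \<Rightarrow> point set" where
  "projectivization W = {P \<in> P3. P \<subseteq> W}"

definition projective_span :: "point set \<Rightarrow> point set" where
  "projective_span S = projectivization (vec.span (\<Union>S))"

definition vanishes_at :: "poly4 \<Rightarrow> point \<Rightarrow> bool" where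
  "vanishes_at f P \<longleftrightarrow> (\<forall>x\<in>P. eval4 f x = 0)"

definition zariski_closed :: "point set \<Rightarrow> bool" where
  "zariski_closed X \<longleftrightarrow>
     (\<exists>S. (\<forall>f\<in>S. \<exists>d. homogeneous4 d f) \<and> X = {P \<in> P3. \<forall>f\<in>S. vanishes_at f P})"

definition zariski_closure :: "point set \<Rightarrow> point set" where
  "zariski_closure X = zariski_closed hull X"

text \<open>The ideal of all polynomials vanishing on the affine cone over \<open>X\<close>. As the field is
  infinite, this is the ideal generated by the homogeneous polynomials vanishing on \<open>X\<close>.\<close>

definition vanishing_ideal :: "point set \<Rightarrow> poly4 set" where
  "vanishing_ideal X = {f. \<forall>P\<in>X. vanishes_at f P}"

text \<open>The degree of a surface is the degree of a generator of its vanishing ideal. In this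
  unique factorization domain, that ideal is principal with a nonzero nonunit generator
  exactly when the nonempty closed set \<open>X\<close> is of pure dimension two.\<close>

definition surface_of_degree :: "nat \<Rightarrow> point set \<Rightarrow> bool" where
  "surface_of_degree d X \<longleftrightarrow> zariski_closed X \<and> d > 0 \<and>
     (\<exists>F. F \<noteq> 0 \<and> homogeneous4 d F \<and> vanishing_ideal X = {G. F dvd G})"


section \<open>Conics and tangent lines\<close>

text \<open>A conic in the plane of \<open>W\<close> is cut out by a quadratic form \<open>q\<close>; smoothness is the Jacobian
  criterion for the restriction of \<open>q\<close> to \<open>W\<close>. It forces this restriction to be nonzero and
  excludes pairs of lines and double lines.\<close>

definition smooth_conic :: "point set \<Rightarrow> bool" where
  "smooth_conic C \<longleftrightarrow>
     (\<exists>W q. vec.subspace W \<and> vec.dim W = 3 \<and> homogeneous4 2 q \<and>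
        C = {P \<in> projectivization W. vanishes_at q P} \<and>
        (\<forall>P\<in>C. \<forall>x\<in>P - {0}. \<exists>v\<in>W. differential4 q x v \<noteq> 0))"

text \<open>The embedded projective tangent space: the zero locus of the differentials at \<open>P\<close> of all
  polynomials vanishing on \<open>C\<close>. For a smooth curve this is the tangent line.\<close>

definition tangent_line :: "point set \<Rightarrow> point \<Rightarrow> point set" where
  "tangent_line C P =
     projectivization {v. \<forall>f\<in>vanishing_ideal C. \<forall>x\<in>P - {0}. differential4 f x v = 0}"

text \<open>Since \<open>P\<close> lies on its tangent line, a point of tangency automatically lies in the plane.\<close>

definition tangent_to_plane :: "point set \<Rightarrow> point set \<Rightarrow> bool" where
  "tangent_to_plane C H \<longleftrightarrow> (\<exists>P\<in>C. tangent_line C P \<subseteq> H)"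


section \<open>The edge surface\<close>

definition stationary_bisecants :: "point set \<Rightarrow> point set \<Rightarrow> point set set" where
  "stationary_bisecants C1 C2 =
     {projective_span {p, q} | p q. p \<in> C1 \<and> q \<in> C2 \<and> p \<noteq> q \<and>
        tangent_line C1 p \<inter> tangent_line C2 q \<noteq> {}}"

definition edge_surface :: "point set \<Rightarrow> point set \<Rightarrow> point set" where
  "edge_surface C1 C2 = zariski_closure (\<Union>(stationary_bisecants C1 C2))"

end

theory Submission
  imports Defs "HOL-Computational_Algebra.Fundamental_Theorem_Algebra"
begin

text \<open>The proof computes the edge surface in suitable coordinates and recognizes its equation as a
discriminant of degree eight.

The planes of the two conics meet in a line \<open>L\<close>. As neither conic is tangent to the plane of
the other, both quadratic forms are nondegenerate on \<open>L\<close>; as the conics are disjoint, they have no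
common zero there, so that they can be diagonalized simultaneously with distinct eigenvalues.
Completing the resulting basis of \<open>L\<close> by the poles of \<open>L\<close> with respect to the conics yields
coordinates (\<open>conic_pair_normal_form\<close>) in which the conics are
\<open>x\<^sub>1\<^sup>2 + x\<^sub>2\<^sup>2 + x\<^sub>3\<^sup>2 = 0 = x\<^sub>4\<close> and \<open>x\<^sub>1\<^sup>2 / a + x\<^sub>2\<^sup>2 / b + x\<^sub>4\<^sup>2 = 0 = x\<^sub>3\<close>, with \<open>a \<noteq> b\<close> both
nonzero. Two tangent lines can meet only on \<open>L\<close>, and they do so exactly if the points of tangency
are \<open>(u, v, z, 0)\<close> and \<open>(a u, b v, 0, w)\<close> up to scaling. The bisecants therefore consist of the points
\<open>((s + t a) u, (s + t b) v, s z, t w)\<close> with \<open>u\<^sup>2 + v\<^sup>2 + z\<^sup>2 = 0 = a u\<^sup>2 + b v\<^sup>2 + w\<^sup>2\<close>.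

Where no denominator vanishes, eliminating \<open>u\<close>, \<open>v\<close>, \<open>z\<close> and \<open>w\<close> turns these two equations into the
condition that the partial derivatives with respect to
\<open>s\<close> and \<open>t\<close> of the function
\<open>x\<^sub>1\<^sup>2 / (s + t a) + x\<^sub>2\<^sup>2 / (s + t b) + x\<^sub>3\<^sup>2 / s + x\<^sub>4\<^sup>2 / t\<close> vanish, that is, that the
binary cubic obtained by clearing its denominators has \<open>(s, t)\<close> as a double root. The coefficients of
this cubic are linear in the squares of the coordinates, and the discriminant of a cubic has degree
four in the coefficients, so the discriminant \<open>edge_form\<close> is a form of degree eight vanishing on the
surface.

It remains to show that this form generates the whole ideal (\<open>edge_form_divides\<close>), which also
shows that it has no repeated factors. It is monic in \<open>x\<^sub>1\<close> up to the constant \<open>b\<^sup>2\<close>, so a polynomial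
vanishing on the surface can be divided by it with a remainder of degree less than eight in \<open>x\<^sub>1\<close>. On
the other hand, for generic \<open>x\<^sub>2\<close>, \<open>x\<^sub>3\<close> and \<open>x\<^sub>4\<close> there are eight values of \<open>x\<^sub>1\<close> that give points on
bisecants (\<open>edge_cone_fibre\<close>): the ratio \<open>t / s\<close> is a root of a quartic with simple roots, each root
determines \<open>x\<^sub>1\<^sup>2\<close>, and different roots give different values because a cubic has at most one double
root. So the remainder vanishes.\<close>

section \<open>Polynomials as functions\<close>

text \<open>Over an infinite field a polynomial is determined by its values, and divisibility and homogeneity
can be tested on values (see \<open>eval4_inject\<close>, \<open>dvd_iff_polyfun\<close> and \<open>homogeneous4_iff\<close> below). The
geometric arguments are therefore carried out with functions, where a linear change of coordinates is
just a composition.\<close>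

definition polyfun :: "(complex^4 \<Rightarrow> complex) \<Rightarrow> bool" where
  "polyfun g \<longleftrightarrow> (\<exists>f. g = eval4 f)"

lemma polyfunI: "(\<And>x. g x = eval4 f x) \<Longrightarrow> polyfun g"
  unfolding polyfun_def by (rule exI [of _ f]) (rule ext)

lemma polyfunE:
  assumes "polyfun g" obtains f where "g = eval4 f"
  using assms unfolding polyfun_def by blast

lemma eval4_superset:
  assumes "finite S" "Poly_Mapping.keys f \<subseteq> S"
  shows "eval4 f x = (\<Sum>m\<in>S. Poly_Mapping.lookup f m * (\<Prod>i\<in>UNIV. (x $ i) ^ Poly_Mapping.lookup m i))"
  unfolding eval4_def using assms
  by (intro sum.mono_neutral_left) (auto simp: in_keys_iff)

lemma eval4_zero [simp]: "eval4 0 x = 0"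
  by (simp add: eval4_def)

lemma eval4_single [simp]:
  "eval4 (Poly_Mapping.single m c) x = c * (\<Prod>i\<in>UNIV. (x $ i) ^ Poly_Mapping.lookup m i)"
  by (subst eval4_superset [of "{m}"]) auto

lemma eval4_add [simp]: "eval4 (f + g) x = eval4 f x + eval4 g x"
proof -
  let ?S = "Poly_Mapping.keys f \<union> Poly_Mapping.keys g"
  have "Poly_Mapping.keys (f + g) \<subseteq> ?S" by (rule Poly_Mapping.keys_add)
  then show ?thesis
    by (simp add: eval4_superset [of ?S] lookup_add algebra_simps sum.distrib)
qed

lemma poly4_induct [case_names single add]:
  fixes f :: poly4
  assumes single: "\<And>m c. P (Poly_Mapping.single m c)" and add: "\<And>f g. P f \<Longrightarrow> P g \<Longrightarrow> P (f + g)"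
  shows "P f"
proof (induction f rule: Poly_Mapping.update_induct)
  case const
  show ?case using single [of 0 0] by simp
next
  case (update f a b)
  have "Poly_Mapping.update a b f = f + Poly_Mapping.single a b"
    using update by (intro poly_mapping_eqI) (auto simp: lookup_update lookup_add lookup_single in_keys_iff when_def)
  then show ?case using update add single by metis
qed

lemma eval4_mult [simp]: "eval4 (f * g) x = eval4 f x * eval4 g x"
proof (induction f rule: poly4_induct)
  case (single m c)
  show ?case
  proof (induction g rule: poly4_induct)
    case (single m' c')
    show ?case by (simp add: mult_single lookup_add power_add prod.distrib)
  qed (simp add: distrib_left)
qed (simp add: distrib_right)

lemma polyfun_const [intro!, simp]: "polyfun (\<lambda>x. c)"
  by (rule polyfunI [of _ "Poly_Mapping.single 0 c"]) simp

lemma polyfun_coord [intro!, simp]: "polyfun (\<lambda>x. x $ i)"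
proof -
  have "(\<Prod>j\<in>UNIV. (x $ j) ^ (if j = i then 1 else 0)) = x $ i" for x :: "complex^4"
    using prod.delta [of UNIV i "\<lambda>j. x $ j"] by (simp add: if_distrib [of "\<lambda>n. _ ^ n"] cong: if_cong)
  then have "eval4 (Poly_Mapping.single (Poly_Mapping.single i 1) 1) x = x $ i" for x :: "complex^4"
    by (simp add: lookup_single when_def eq_commute [of i] cong: if_cong)
  then show ?thesis by (intro polyfunI [of _ "Poly_Mapping.single (Poly_Mapping.single i 1) 1"]) simp
qed

lemma polyfun_eval4 [intro!, simp]: "polyfun (eval4 f)"
  by (auto simp: polyfun_def)

lemma polyfun_add [intro]: "polyfun f \<Longrightarrow> polyfun g \<Longrightarrow> polyfun (\<lambda>x. f x + g x)"
  by (elim polyfunE, hypsubst, rule polyfunI, rule eval4_add [symmetric])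

lemma polyfun_mult [intro]: "polyfun f \<Longrightarrow> polyfun g \<Longrightarrow> polyfun (\<lambda>x. f x * g x)"
  by (elim polyfunE, hypsubst, rule polyfunI, rule eval4_mult [symmetric])

lemma polyfun_diff [intro]: "polyfun f \<Longrightarrow> polyfun g \<Longrightarrow> polyfun (\<lambda>x. f x - g x)"
  using polyfun_add [of f "\<lambda>x. (- 1) * g x"] polyfun_mult [of "\<lambda>x. - 1" g] by simp

lemma polyfun_power [intro]: "polyfun f \<Longrightarrow> polyfun (\<lambda>x. f x ^ n)"
  by (induction n) auto

lemma polyfun_sum [intro]: "(\<And>i. i \<in> I \<Longrightarrow> polyfun (f i)) \<Longrightarrow> polyfun (\<lambda>x. \<Sum>i\<in>I. f i x)"
  by (induction I rule: infinite_finite_induct) auto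

lemma polyfun_induct [consumes 1, case_names const coord add mult]:
  assumes "polyfun f"
    and const: "\<And>c. P (\<lambda>x. c)" and coord: "\<And>i. P (\<lambda>x. x $ i)"
    and add: "\<And>f g. polyfun f \<Longrightarrow> polyfun g \<Longrightarrow> P f \<Longrightarrow> P g \<Longrightarrow> P (\<lambda>x. f x + g x)"
    and mult: "\<And>f g. polyfun f \<Longrightarrow> polyfun g \<Longrightarrow> P f \<Longrightarrow> P g \<Longrightarrow> P (\<lambda>x. f x * g x)"
  shows "P f"
proof -
  let ?Q = "\<lambda>f. polyfun f \<and> P f"
  have pow: "?Q (\<lambda>x. (x $ i) ^ n)" for i n
    by (induction n) (auto intro: const coord mult)
  have prod: "finite I \<Longrightarrow> ?Q (\<lambda>x. \<Prod>i\<in>I. (x $ i) ^ e i)" for e and I :: "4 set"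
  proof (induction I rule: finite_induct)
    case (insert j I)
    then show ?case using mult [of "\<lambda>x. (x $ j) ^ e j"] pow [of j "e j"] by (simp add: polyfun_mult)
  qed (simp add: const)
  have mono: "?Q (\<lambda>x. c * (\<Prod>i\<in>UNIV. (x $ i) ^ Poly_Mapping.lookup m i))" for m c
    using prod [of UNIV "Poly_Mapping.lookup m"] const [of c] by (simp add: mult polyfun_mult)
  have "?Q (eval4 h)" for h
  proof (induction h rule: poly4_induct)
    case (single m c)
    have "eval4 (Poly_Mapping.single m c) = (\<lambda>x. c * (\<Prod>i\<in>UNIV. (x $ i) ^ Poly_Mapping.lookup m i))"
      by (simp add: fun_eq_iff)
    then show ?case using mono [of c m] by simp
  next
    case (add f g)
    have "eval4 (f + g) = (\<lambda>x. eval4 f x + eval4 g x)" by (simp add: fun_eq_iff)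
    then show ?case using add assms(4) polyfun_add [of "eval4 f" "eval4 g"] by simp
  qed
  then show ?thesis using assms(1) by (auto simp: polyfun_def)
qed

lemma polyfun_linear_subst:
  assumes "polyfun f"
  shows "polyfun (\<lambda>x. f (M *v x))"
  using assms
proof (induction f rule: polyfun_induct)
  case (coord i)
  show ?case unfolding matrix_vector_mult_def by auto
qed auto

lemma polyfun_on_line:
  assumes "polyfun f"
  obtains p where "\<And>t. f (x + t *s v) = poly p t"
proof -
  have "\<exists>p. \<forall>t. f (x + t *s v) = poly p t"
    using assms
  proof (induction f rule: polyfun_induct)
    case (const c)
    show ?case by (rule exI [of _ "[:c:]"]) simp
  next
    case (coord i)
    show ?case by (rule exI [of _ "[:x $ i, v $ i:]"]) (simp add: mult.commute)
  next
    case (add f g)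
    then obtain p q where "\<forall>t. f (x + t *s v) = poly p t" "\<forall>t. g (x + t *s v) = poly q t" by blast
    then show ?case by (intro exI [of _ "p + q"]) simp
  next
    case (mult f g)
    then obtain p q where "\<forall>t. f (x + t *s v) = poly p t" "\<forall>t. g (x + t *s v) = poly q t" by blast
    then show ?case by (intro exI [of _ "p * q"]) simp
  qed
  then show ?thesis using that by blast
qed

text \<open>Partial derivatives are only needed through the chain rule along curves: the derivative of \<open>f\<close> along a
curve through \<open>x\<close> depends linearly on the velocity.\<close>

lemma polyfun_gradient:
  assumes "polyfun f"
  obtains d where "\<And>\<gamma> \<gamma>'. \<gamma> 0 = x \<Longrightarrow> (\<And>i. ((\<lambda>t. \<gamma> t $ i) has_field_derivative \<gamma>' $ i) (at 0))
    \<Longrightarrow> ((\<lambda>t. f (\<gamma> t)) has_field_derivative (\<Sum>i\<in>UNIV. d i * \<gamma>' $ i)) (at 0)"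
proof -
  have "\<exists>d. \<forall>\<gamma> \<gamma>'. \<gamma> 0 = x \<longrightarrow> (\<forall>i. ((\<lambda>t. \<gamma> t $ i) has_field_derivative \<gamma>' $ i) (at 0))
    \<longrightarrow> ((\<lambda>t. f (\<gamma> t)) has_field_derivative (\<Sum>i\<in>UNIV. d i * \<gamma>' $ i)) (at 0)"
    using assms
  proof (induction f rule: polyfun_induct)
    case (const c)
    show ?case by (rule exI [of _ "\<lambda>i. 0"]) simp
  next
    case (coord i)
    show ?case
      by (rule exI [of _ "\<lambda>j. if j = i then 1 else 0"])
        (simp add: if_distrib [of "\<lambda>n. n * _"] cong: if_cong)
  next
    case (add f g)
    then obtain d e where d: "\<And>\<gamma> \<gamma>'. \<gamma> 0 = x \<Longrightarrow> (\<And>i. ((\<lambda>t. \<gamma> t $ i) has_field_derivative \<gamma>' $ i) (at 0))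
          \<Longrightarrow> ((\<lambda>t. f (\<gamma> t)) has_field_derivative (\<Sum>i\<in>UNIV. d i * \<gamma>' $ i)) (at 0)"
      and e: "\<And>\<gamma> \<gamma>'. \<gamma> 0 = x \<Longrightarrow> (\<And>i. ((\<lambda>t. \<gamma> t $ i) has_field_derivative \<gamma>' $ i) (at 0))
          \<Longrightarrow> ((\<lambda>t. g (\<gamma> t)) has_field_derivative (\<Sum>i\<in>UNIV. e i * \<gamma>' $ i)) (at 0)"
      by blast
    show ?case
    proof (intro exI [of _ "\<lambda>i. d i + e i"] allI impI)
      fix \<gamma> :: "complex \<Rightarrow> complex^4" and \<gamma>'
      assume "\<gamma> 0 = x" "\<forall>i. ((\<lambda>t. \<gamma> t $ i) has_field_derivative \<gamma>' $ i) (at 0)"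
      with DERIV_add [OF d [of \<gamma> \<gamma>'] e [of \<gamma> \<gamma>']]
      show "((\<lambda>t. f (\<gamma> t) + g (\<gamma> t)) has_field_derivative (\<Sum>i\<in>UNIV. (d i + e i) * \<gamma>' $ i)) (at 0)"
        by (simp add: distrib_right sum.distrib)
    qed
  next
    case (mult f g)
    then obtain d e where d: "\<And>\<gamma> \<gamma>'. \<gamma> 0 = x \<Longrightarrow> (\<And>i. ((\<lambda>t. \<gamma> t $ i) has_field_derivative \<gamma>' $ i) (at 0))
          \<Longrightarrow> ((\<lambda>t. f (\<gamma> t)) has_field_derivative (\<Sum>i\<in>UNIV. d i * \<gamma>' $ i)) (at 0)"
      and e: "\<And>\<gamma> \<gamma>'. \<gamma> 0 = x \<Longrightarrow> (\<And>i. ((\<lambda>t. \<gamma> t $ i) has_field_derivative \<gamma>' $ i) (at 0))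
          \<Longrightarrow> ((\<lambda>t. g (\<gamma> t)) has_field_derivative (\<Sum>i\<in>UNIV. e i * \<gamma>' $ i)) (at 0)"
      by blast
    show ?case
    proof (intro exI [of _ "\<lambda>i. d i * g x + e i * f x"] allI impI)
      fix \<gamma> :: "complex \<Rightarrow> complex^4" and \<gamma>'
      assume "\<gamma> 0 = x" "\<forall>i. ((\<lambda>t. \<gamma> t $ i) has_field_derivative \<gamma>' $ i) (at 0)"
      with DERIV_mult [OF d [of \<gamma> \<gamma>'] e [of \<gamma> \<gamma>']]
      show "((\<lambda>t. f (\<gamma> t) * g (\<gamma> t)) has_field_derivative
          (\<Sum>i\<in>UNIV. (d i * g x + e i * f x) * \<gamma>' $ i)) (at 0)"
        by (simp add: algebra_simps sum.distrib sum_distrib_left)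
    qed
  qed
  then show ?thesis using that by blast
qed

lemma vector_4 [simp]:
  "(vector [a, b, c, d] :: 'a::zero^4) $ 1 = a" "(vector [a, b, c, d] :: 'a::zero^4) $ 2 = b"
  "(vector [a, b, c, d] :: 'a::zero^4) $ 3 = c" "(vector [a, b, c, d] :: 'a::zero^4) $ 4 = d"
  by (simp_all add: vector_def)

lemma prod_4: "prod f (UNIV :: 4 set) = f 1 * f 2 * f 3 * f 4"
  unfolding UNIV_4 by (simp add: ac_simps)

lemma base_expansion_inj:
  fixes N :: nat
  assumes "a < N" "a' < N" "a + N * b = a' + N * b'"
  shows "a = a' \<and> b = b'"
proof -
  have "a = a'" using arg_cong [OF assms(3), of "\<lambda>n. n mod N"] assms(1,2) by simp
  then show ?thesis using assms by auto
qed

text \<open>Kronecker's substitution \<open>(t, t\<^sup>N, \<dots>)\<close>, whose exponents are \<open>1\<close>, \<open>N\<close>, \<open>N\<^sup>2\<close> and \<open>N\<^sup>3\<close>, with \<open>N\<close> above all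
exponents of \<open>f\<close>, sends distinct monomials of \<open>f\<close> to distinct powers of \<open>t\<close>: exponent vectors become
numbers in base \<open>N\<close>.\<close>

lemma eval4_eq_zeroD:
  assumes zero: "\<And>x. eval4 f x = 0"
  shows "f = 0"
proof -
  let ?l = Poly_Mapping.lookup
  define N where "N = Suc (\<Sum>m\<in>Poly_Mapping.keys f. \<Sum>i\<in>UNIV. ?l m i)"
  have bound: "?l m i < N" if "m \<in> Poly_Mapping.keys f" for m i
  proof -
    have "?l m i \<le> (\<Sum>i\<in>UNIV. ?l m i)" by (rule member_le_sum) auto
    also have "\<dots> \<le> (\<Sum>m\<in>Poly_Mapping.keys f. \<Sum>i\<in>UNIV. ?l m i)"
      using that by (intro member_le_sum) auto
    finally show ?thesis by (simp add: N_def)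
  qed
  define e where "e m = ?l m 1 + N * (?l m 2 + N * (?l m 3 + N * ?l m 4))" for m :: "4 \<Rightarrow>\<^sub>0 nat"
  have inj: "inj_on e (Poly_Mapping.keys f)"
  proof (rule inj_onI)
    fix m m' assume m: "m \<in> Poly_Mapping.keys f" "m' \<in> Poly_Mapping.keys f" and eq: "e m = e m'"
    note base = base_expansion_inj [OF bound [OF m(1)] bound [OF m(2)]]
    have 1: "?l m 1 = ?l m' 1" "?l m 2 + N * (?l m 3 + N * ?l m 4) = ?l m' 2 + N * (?l m' 3 + N * ?l m' 4)"
      using base eq unfolding e_def by blast+
    have 2: "?l m 2 = ?l m' 2" "?l m 3 + N * ?l m 4 = ?l m' 3 + N * ?l m' 4"
      using base [OF 1(2)] by blast+
    have 3: "?l m 3 = ?l m' 3" "?l m 4 = ?l m' 4"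
      using base [OF 2(2)] by blast+
    show "m = m'"
    proof (rule poly_mapping_eqI)
      fix i
      have "\<forall>i. ?l m i = ?l m' i" using 1(1) 2(1) 3 by (simp add: forall_4)
      then show "?l m i = ?l m' i" by blast
    qed
  qed
  define p where "p = (\<Sum>m\<in>Poly_Mapping.keys f. Polynomial.monom (?l f m) (e m))"
  have "poly p t = 0" for t
  proof -
    have "(\<Prod>i\<in>UNIV. ((vector [t, t ^ N, t ^ (N * N), t ^ (N * (N * N))] :: complex^4) $ i) ^ ?l m i) = t ^ e m" for m
      by (simp add: prod_4 e_def power_add power_mult distrib_left mult.assoc)
    then show ?thesis
      using zero [of "vector [t, t ^ N, t ^ (N * N), t ^ (N * (N * N))]"]
      by (simp add: eval4_def p_def poly_sum poly_monom)
  qed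
  then have p0: "p = 0" by (metis poly_all_0_iff_0)
  have "?l f m = 0" if "m \<in> Poly_Mapping.keys f" for m
  proof -
    have "0 = coeff p (e m)" by (simp add: p0)
    also have "\<dots> = (\<Sum>m'\<in>Poly_Mapping.keys f. if m' = m then ?l f m' else 0)"
      unfolding p_def coeff_sum
      by (intro sum.cong) (auto dest: inj_onD [OF inj] simp: that)
    also have "\<dots> = ?l f m" using that by simp
    finally show ?thesis by simp
  qed
  then show ?thesis by (metis in_keys_iff poly_mapping_eqI lookup_zero)
qed

lemma eval4_diff: "eval4 (f - g) x = eval4 f x - eval4 g x"
  using eval4_add [of "f - g" g x] by simp

lemma eval4_inject: "(\<And>x. eval4 f x = eval4 g x) \<Longrightarrow> f = g"
  using eval4_eq_zeroD [of "f - g"] by (simp add: eval4_diff)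

lemma dvd_iff_polyfun:
  "F dvd G \<longleftrightarrow> (\<exists>q. polyfun q \<and> (\<forall>x. eval4 G x = eval4 F x * q x))"
proof
  assume "F dvd G"
  then show "\<exists>q. polyfun q \<and> (\<forall>x. eval4 G x = eval4 F x * q x)"
    by (metis dvdE eval4_mult polyfun_eval4)
next
  assume "\<exists>q. polyfun q \<and> (\<forall>x. eval4 G x = eval4 F x * q x)"
  then obtain Q where "\<And>x. eval4 G x = eval4 F x * eval4 Q x" by (auto simp: polyfun_def)
  then have "G = F * Q" by (intro eval4_inject) simp
  then show "F dvd G" by simp
qed

definition component4 :: "nat \<Rightarrow> poly4 \<Rightarrow> poly4" where
  "component4 d f = (\<Sum>m | m \<in> Poly_Mapping.keys f \<and> (\<Sum>i\<in>UNIV. Poly_Mapping.lookup m i) = d.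
      Poly_Mapping.single m (Poly_Mapping.lookup f m))"

lemma lookup_component4:
  "Poly_Mapping.lookup (component4 d f) m =
    (if (\<Sum>i\<in>UNIV. Poly_Mapping.lookup m i) = d then Poly_Mapping.lookup f m else 0)"
  by (auto simp: component4_def lookup_sum lookup_single when_def in_keys_iff)

lemma homogeneous4_component4: "homogeneous4 d (component4 d f)"
  by (auto simp: homogeneous4_def in_keys_iff lookup_component4 split: if_splits)

lemma eval4_homogeneous: "homogeneous4 d f \<Longrightarrow> eval4 f (t *s x) = t ^ d * eval4 f x"
  by (auto simp: eval4_def homogeneous4_def power_mult_distrib prod.distrib sum_distrib_left
      mult_ac simp flip: power_sum intro!: sum.cong)

lemma eval4_component_expansion:
  obtains n where "\<And>t x. eval4 f (t *s x) = (\<Sum>d<n. t ^ d * eval4 (component4 d f) x)"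
    and "f = (\<Sum>d<n. component4 d f)"
proof -
  define n where "n = Suc (\<Sum>m\<in>Poly_Mapping.keys f. \<Sum>i\<in>UNIV. Poly_Mapping.lookup m i)"
  have lt: "(\<Sum>i\<in>UNIV. Poly_Mapping.lookup m i) < n" if "m \<in> Poly_Mapping.keys f" for m
    unfolding n_def less_Suc_eq_le using that by (intro member_le_sum) auto
  have f: "f = (\<Sum>d<n. component4 d f)"
    using lt by (intro poly_mapping_eqI) (auto simp: lookup_sum lookup_component4 in_keys_iff)
  have sum: "eval4 (\<Sum>d<k. g d) x = (\<Sum>d<k. eval4 (g d) x)" for g x and k :: nat
    by (induction k) auto
  have "eval4 f (t *s x) = (\<Sum>d<n. t ^ d * eval4 (component4 d f) x)" for t x
    using arg_cong [OF f, of "\<lambda>g. eval4 g (t *s x)"] unfolding sum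
    by (simp add: eval4_homogeneous [OF homogeneous4_component4])
  then show ?thesis using f that by blast
qed

text \<open>The values of the homogeneous components at \<open>x\<close> are the coefficients of the restriction of \<open>f\<close> to the
line through the origin and \<open>x\<close>.\<close>

lemma component4_eq_coeff:
  assumes "\<And>t. eval4 f (t *s x) = poly p t"
  shows "eval4 (component4 d f) x = coeff p d"
proof -
  obtain n where n: "\<And>t x. eval4 f (t *s x) = (\<Sum>d<n. t ^ d * eval4 (component4 d f) x)"
    and f: "f = (\<Sum>d<n. component4 d f)"
    by (rule eval4_component_expansion [of f]) (rule that)
  have "poly p t = poly (\<Sum>d<n. Polynomial.monom (eval4 (component4 d f) x) d) t" for t
    using n [of t x] assms [of t] by (simp add: poly_sum poly_monom mult.commute)
  then have p: "p = (\<Sum>d<n. Polynomial.monom (eval4 (component4 d f) x) d)"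
    using poly_eq_poly_eq_iff by blast
  show ?thesis
  proof (cases "d < n")
    case False
    have "component4 d f = 0"
    proof (rule poly_mapping_eqI)
      fix m
      have "Poly_Mapping.lookup f m = 0" if "(\<Sum>i\<in>UNIV. Poly_Mapping.lookup m i) = d"
        using arg_cong [OF f, of "\<lambda>g. Poly_Mapping.lookup g m"] that False
        by (simp add: lookup_sum lookup_component4)
      then show "Poly_Mapping.lookup (component4 d f) m = Poly_Mapping.lookup 0 m"
        by (simp add: lookup_component4)
    qed
    then show ?thesis using False by (simp add: p coeff_sum)
  qed (simp add: p coeff_sum)
qed

lemma homogeneous4_iff:
  "homogeneous4 d f \<longleftrightarrow> (\<forall>t x. eval4 f (t *s x) = t ^ d * eval4 f x)"
proof
  assume hom: "\<forall>t x. eval4 f (t *s x) = t ^ d * eval4 f x"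
  have "eval4 (component4 d f) x = eval4 f x" for x
    using component4_eq_coeff [of f x "Polynomial.monom (eval4 f x) d" d] hom
    by (simp add: poly_monom mult.commute)
  then have "component4 d f = f" by (intro eval4_inject)
  then show "homogeneous4 d f" using homogeneous4_component4 [of d f] by simp
qed (simp add: eval4_homogeneous)

section \<open>Division by a polynomial that is monic in the first coordinate\<close>

text \<open>Coefficients for the expansion in powers of the first coordinate. Being independent of that coordinate
is expressed as invariance under translations along its axis.\<close>

definition x1free :: "(complex^4 \<Rightarrow> complex) \<Rightarrow> bool" where
  "x1free g \<longleftrightarrow> polyfun g \<and> (\<forall>x t. g (x + t *s axis 1 1) = g x)"

lemma x1free_const [intro!, simp]: "x1free (\<lambda>x. c)"
  by (simp add: x1free_def)

lemma x1free_coord [intro, simp]: "i \<noteq> 1 \<Longrightarrow> x1free (\<lambda>x. x $ i)"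
  by (simp add: x1free_def axis_def)

lemma x1free_add [intro]: "x1free f \<Longrightarrow> x1free g \<Longrightarrow> x1free (\<lambda>x. f x + g x)"
  by (auto simp: x1free_def)

lemma x1free_mult [intro]: "x1free f \<Longrightarrow> x1free g \<Longrightarrow> x1free (\<lambda>x. f x * g x)"
  by (auto simp: x1free_def)

lemma x1free_diff [intro]: "x1free f \<Longrightarrow> x1free g \<Longrightarrow> x1free (\<lambda>x. f x - g x)"
  by (auto simp: x1free_def)

lemma x1free_power [intro]: "x1free f \<Longrightarrow> x1free (\<lambda>x. f x ^ n)"
  by (auto simp: x1free_def)

definition x1deg_less :: "nat \<Rightarrow> (complex^4 \<Rightarrow> complex) \<Rightarrow> bool" where
  "x1deg_less n g \<longleftrightarrow> (\<exists>r. (\<forall>i. x1free (r i)) \<and> (\<forall>x. g x = (\<Sum>i<n. r i x * (x $ 1) ^ i)))"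

lemma x1deg_less_mono:
  assumes "x1deg_less m g" "m \<le> n"
  shows "x1deg_less n g"
proof -
  obtain r where r: "\<And>i. x1free (r i)" "\<And>x. g x = (\<Sum>i<m. r i x * (x $ 1) ^ i)"
    using assms(1) by (auto simp: x1deg_less_def)
  have "g x = (\<Sum>i<n. (if i < m then r i else (\<lambda>x. 0)) x * (x $ 1) ^ i)" for x
    unfolding r(2) using \<open>m \<le> n\<close> by (intro sum.mono_neutral_cong_left) auto
  then show ?thesis using r(1) unfolding x1deg_less_def
    by (intro exI [of _ "\<lambda>i. if i < m then r i else (\<lambda>x. 0)"]) auto
qed

lemma x1deg_less_add:
  assumes "x1deg_less n f" "x1deg_less n g"
  shows "x1deg_less n (\<lambda>x. f x + g x)"
proof -
  obtain r s where "\<And>i. x1free (r i)" "\<And>x. f x = (\<Sum>i<n. r i x * (x $ 1) ^ i)"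
    "\<And>i. x1free (s i)" "\<And>x. g x = (\<Sum>i<n. s i x * (x $ 1) ^ i)"
    using assms by (auto simp: x1deg_less_def)
  then show ?thesis unfolding x1deg_less_def
    by (intro exI [of _ "\<lambda>i x. r i x + s i x"]) (auto simp: distrib_right sum.distrib)
qed

lemma x1deg_less_monomial:
  assumes "x1free r" "i < n"
  shows "x1deg_less n (\<lambda>x. r x * (x $ 1) ^ i)"
proof -
  have "r x * (x $ 1) ^ i = (\<Sum>j<n. (if j = i then r else (\<lambda>x. 0)) x * (x $ 1) ^ j)" for x
    using assms(2) by (simp add: if_distrib [of "\<lambda>r. r x * _"] cong: if_cong)
  then show ?thesis using assms(1) unfolding x1deg_less_def
    by (intro exI [of _ "\<lambda>j. if j = i then r else (\<lambda>x. 0)"]) auto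
qed

lemma x1deg_less_zero [simp]: "x1deg_less n (\<lambda>x. 0)"
  unfolding x1deg_less_def by (intro exI [of _ "\<lambda>i x. 0"]) auto

lemma x1deg_less_sum:
  "finite I \<Longrightarrow> (\<And>i. i \<in> I \<Longrightarrow> x1deg_less n (f i)) \<Longrightarrow> x1deg_less n (\<lambda>x. \<Sum>i\<in>I. f i x)"
  by (induction I rule: finite_induct) (auto intro: x1deg_less_add)

lemma x1deg_less_mult:
  assumes "x1deg_less m f" "x1deg_less n g"
  shows "x1deg_less (m + n) (\<lambda>x. f x * g x)"
proof -
  obtain r s where r: "\<And>i. x1free (r i)" "\<And>x. f x = (\<Sum>i<m. r i x * (x $ 1) ^ i)"
    and s: "\<And>i. x1free (s i)" "\<And>x. g x = (\<Sum>i<n. s i x * (x $ 1) ^ i)"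
    using assms by (auto simp: x1deg_less_def)
  have "f x * g x = (\<Sum>i<m. \<Sum>j<n. (r i x * s j x) * (x $ 1) ^ (i + j))" for x
    by (simp add: r s sum_product power_add mult_ac)
  moreover have "x1deg_less (m + n) (\<lambda>x. \<Sum>i<m. \<Sum>j<n. (r i x * s j x) * (x $ 1) ^ (i + j))"
    using r(1) s(1) by (auto intro!: x1deg_less_sum x1deg_less_monomial)
  ultimately show ?thesis by simp
qed

lemma x1deg_less_shift:
  assumes "x1deg_less n g" "x1free r"
  shows "x1deg_less (n + k) (\<lambda>x. g x * (r x * (x $ 1) ^ k))"
proof -
  obtain s where s: "\<And>i. x1free (s i)" "\<And>x. g x = (\<Sum>i<n. s i x * (x $ 1) ^ i)"
    using assms by (auto simp: x1deg_less_def)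
  have "g x * (r x * (x $ 1) ^ k) = (\<Sum>i<n. (s i x * r x) * (x $ 1) ^ (i + k))" for x
    by (simp add: s sum_distrib_left power_add mult_ac)
  moreover have "x1deg_less (n + k) (\<lambda>x. \<Sum>i<n. (s i x * r x) * (x $ 1) ^ (i + k))"
    using s(1) assms(2) by (auto intro!: x1deg_less_sum x1deg_less_monomial)
  ultimately show ?thesis by simp
qed

lemma polyfun_imp_x1deg_less:
  assumes "polyfun f"
  shows "\<exists>n. x1deg_less n f"
  using assms
proof (induction f rule: polyfun_induct)
  case (const c)
  show ?case using x1deg_less_monomial [of "\<lambda>x. c" 0 1] by auto
next
  case (coord i)
  show ?case
  proof (cases "i = 1")
    case True
    then show ?thesis using x1deg_less_monomial [of "\<lambda>x. 1" 1 2] by auto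
  next
    case False
    then show ?thesis using x1deg_less_monomial [of "\<lambda>x. x $ i" 0 1] by auto
  qed
next
  case (add f g)
  then obtain m n where "x1deg_less m f" "x1deg_less n g" by blast
  then have "x1deg_less (max m n) (\<lambda>x. f x + g x)"
    by (intro x1deg_less_add) (auto intro: x1deg_less_mono)
  then show ?case ..
next
  case (mult f g)
  then show ?case using x1deg_less_mult by blast
qed

text \<open>The usual division algorithm: a top term \<open>r x\<^sub>1\<^sup>k\<close> with \<open>k \<ge> n\<close> is removed by subtracting
\<open>(r / c) x\<^sub>1\<^bsup>k - n\<^esup> F\<close>.\<close>

lemma monic_division:
  fixes c :: complex
  assumes F: "\<And>x. F x = c * (x $ 1) ^ n + L x" and "c \<noteq> 0" and L: "x1deg_less n L"
    and "polyfun G"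
  obtains Q R where "polyfun Q" "x1deg_less n R" "\<And>x. G x = F x * Q x + R x"
proof -
  have main: "\<exists>Q R. polyfun Q \<and> x1deg_less n R \<and> (\<forall>x. G x = F x * Q x + R x)"
    if "x1deg_less k G" for k G
    using that
  proof (induction k arbitrary: G)
    case 0
    then show ?case
      by (intro exI [of _ "\<lambda>x. 0"] exI [of _ G]) (auto intro: x1deg_less_mono)
  next
    case (Suc k)
    show ?case
    proof (cases "Suc k \<le> n")
      case True
      then show ?thesis using Suc.prems
        by (intro exI [of _ "\<lambda>x. 0"] exI [of _ G]) (auto intro: x1deg_less_mono)
    next
      case False
      obtain r where r: "\<And>i. x1free (r i)" "\<And>x. G x = (\<Sum>i<Suc k. r i x * (x $ 1) ^ i)"
        using Suc.prems by (auto simp: x1deg_less_def)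
      \<comment> \<open>The top term \<open>r k x * (x $ 1) ^ k\<close> equals \<open>q x * (F x - L x)\<close>.\<close>
      define q where "q x = (r k x * (1 / c)) * (x $ 1) ^ (k - n)" for x
      define G' where "G' x = (\<Sum>i<k. r i x * (x $ 1) ^ i) + L x * ((r k x * (- 1 / c)) * (x $ 1) ^ (k - n))" for x
      have "x1deg_less (n + (k - n)) (\<lambda>x. L x * ((r k x * (- 1 / c)) * (x $ 1) ^ (k - n)))"
        by (intro x1deg_less_shift L x1free_mult r(1) x1free_const)
      then have "x1deg_less k G'" unfolding G'_def using False r(1)
        by (intro x1deg_less_add) (auto intro!: x1deg_less_sum x1deg_less_monomial)
      then obtain Q R where QR: "polyfun Q" "x1deg_less n R" "\<And>x. G' x = F x * Q x + R x"
        using Suc.IH by blast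
      have "polyfun (r k)" using r(1) by (simp add: x1free_def)
      then have "polyfun q" unfolding q_def
        by (intro polyfun_mult polyfun_power polyfun_coord polyfun_const)
      have "G x = F x * q x + G' x" for x
      proof -
        have "(x $ 1) ^ k = (x $ 1) ^ n * (x $ 1) ^ (k - n)"
          using False by (simp flip: power_add)
        then show ?thesis using \<open>c \<noteq> 0\<close>
          by (simp add: r(2) F q_def G'_def field_simps)
      qed
      then have "G x = F x * (q x + Q x) + R x" for x using QR(3) by (simp add: algebra_simps)
      then show ?thesis using QR(1,2) \<open>polyfun q\<close> by blast
    qed
  qed
  then show ?thesis using polyfun_imp_x1deg_less [OF \<open>polyfun G\<close>] that by metis
qed

lemma polyfun_eq_zero_cofinite:
  assumes "polyfun f" "finite Y" "\<And>t. t \<notin> Y \<Longrightarrow> f (x + t *s v) = 0"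
  shows "f x = 0"
proof -
  obtain p where p: "\<And>t. f (x + t *s v) = poly p t" using polyfun_on_line [OF assms(1)] by metis
  have "p = 0"
  proof (rule ccontr)
    assume "p \<noteq> 0"
    then have "finite {t. poly p t = 0}" by (rule poly_roots_finite)
    moreover have "UNIV = Y \<union> {t. poly p t = 0}" using assms(3) p by auto
    ultimately show False using assms(2) infinite_UNIV_char_0 [where 'a = complex]
      by (metis finite_UnI)
  qed
  then show ?thesis using p [of 0] by simp
qed

section \<open>The edge surface in normal form\<close>

text \<open>The affine cone over the union of the stationary bisecants of the conics
\<open>x\<^sub>1\<^sup>2 + x\<^sub>2\<^sup>2 + x\<^sub>3\<^sup>2 = 0 = x\<^sub>4\<close> and \<open>x\<^sub>1\<^sup>2 / a + x\<^sub>2\<^sup>2 / b + x\<^sub>4\<^sup>2 = 0 = x\<^sub>3\<close>. The points \<open>(u, v, z, 0)\<close> of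
the first and \<open>(a u, b v, 0, w)\<close> of the second conic have the common tangent vector \<open>(- v, u, 0, 0)\<close>.\<close>

definition edge_cone :: "complex \<Rightarrow> complex \<Rightarrow> (complex^4) set" where
  "edge_cone a b = {x. \<exists>s t u v z w. u^2 + v^2 + z^2 = 0 \<and> a * u^2 + b * v^2 + w^2 = 0
     \<and> (u \<noteq> 0 \<or> v \<noteq> 0)
     \<and> x = vector [(s + t * a) * u, (s + t * b) * v, s * z, t * w]}"

definition cubic_discriminant :: "complex \<Rightarrow> complex \<Rightarrow> complex \<Rightarrow> complex \<Rightarrow> complex" where
  "cubic_discriminant c0 c1 c2 c3 =
     c1^2 * c2^2 - 4 * c0 * c2^3 - 4 * c1^3 * c3 + 18 * c0 * c1 * c2 * c3 - 27 * c0^2 * c3^2"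

text \<open>The discriminant of the binary cubic
\<open>x\<^sub>1\<^sup>2 S T (S + b T) + x\<^sub>2\<^sup>2 S T (S + a T) + x\<^sub>3\<^sup>2 T (S + a T) (S + b T) + x\<^sub>4\<^sup>2 S (S + a T) (S + b T)\<close>,
written in terms of the coefficients of \<open>S\<^sup>3\<close>, \<open>S\<^sup>2 T\<close>, \<open>S T\<^sup>2\<close> and \<open>T\<^sup>3\<close>.\<close>

definition edge_form :: "complex \<Rightarrow> complex \<Rightarrow> complex^4 \<Rightarrow> complex" where
  "edge_form a b x = cubic_discriminant
     ((x $ 4)^2)
     ((x $ 1)^2 + (x $ 2)^2 + (x $ 3)^2 + (a + b) * (x $ 4)^2)
     (b * (x $ 1)^2 + a * (x $ 2)^2 + (a + b) * (x $ 3)^2 + a * b * (x $ 4)^2)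
     (a * b * (x $ 3)^2)"

text \<open>The cubic with these coefficients is \<open>(t S - s T)\<^sup>2 (g S + h T)\<close>.\<close>

lemma cubic_discriminant_double_root:
  "cubic_discriminant (t^2 * g) (t^2 * h - 2 * s * t * g) (s^2 * g - 2 * s * t * h) (s^2 * h) = 0"
  unfolding cubic_discriminant_def by algebra

text \<open>At a point with parameters \<open>s\<close>, \<open>t\<close>, \<open>u\<close>, \<open>v\<close> the cubic is the product of \<open>(t S - s T)\<^sup>2\<close> and a linear form
in \<open>S\<close> and \<open>T\<close>, whose coefficients are \<open>g\<close> and \<open>h\<close> in the proof.\<close>

lemma edge_form_vanishes:
  assumes "x \<in> edge_cone a b"
  shows "edge_form a b x = 0"
proof -
  obtain s t u v z w where uv: "u^2 + v^2 + z^2 = 0" "a * u^2 + b * v^2 + w^2 = 0"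
    and x: "x = vector [(s + t * a) * u, (s + t * b) * v, s * z, t * w]"
    using assms by (auto simp: edge_cone_def)
  define g where "g = - (a * u^2 + b * v^2)"
  define h where "h = - (a * b * (u^2 + v^2))"
  have zw: "z^2 = - (u^2 + v^2)" "w^2 = - (a * u^2 + b * v^2)"
    using uv by (simp_all add: add_eq_0_iff)
  have "(x $ 4)^2 = t^2 * g"
    by (simp add: x g_def power_mult_distrib zw)
  moreover have "(x $ 1)^2 + (x $ 2)^2 + (x $ 3)^2 + (a + b) * (x $ 4)^2 = t^2 * h - 2 * s * t * g"
    by (simp add: x g_def h_def power_mult_distrib zw) algebra
  moreover have "b * (x $ 1)^2 + a * (x $ 2)^2 + (a + b) * (x $ 3)^2 + a * b * (x $ 4)^2 = s^2 * g - 2 * s * t * h"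
    by (simp add: x g_def h_def power_mult_distrib zw) algebra
  moreover have "a * b * (x $ 3)^2 = s^2 * h"
    by (simp add: x h_def power_mult_distrib zw) algebra
  ultimately show ?thesis unfolding edge_form_def by (simp only: cubic_discriminant_double_root)
qed

lemma edge_form_homogeneous: "edge_form a b (t *s x) = t ^ 8 * edge_form a b x"
  unfolding edge_form_def cubic_discriminant_def vector_smult_component power_mult_distrib
  by algebra

lemma polyfun_edge_form: "polyfun (edge_form a b)"
  unfolding edge_form_def cubic_discriminant_def
  by (intro polyfun_add polyfun_diff polyfun_mult polyfun_power polyfun_coord polyfun_const)

text \<open>The coefficient of \<open>x\<^sub>1\<^sup>8\<close> is the discriminant \<open>b\<^sup>2\<close> of the cubic \<open>S T (S + b T)\<close> that \<open>x\<^sub>1\<^sup>2\<close>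
multiplies. The lower terms \<open>f3\<close>, \<open>f2\<close>, \<open>f1\<close> and \<open>f0\<close> are the coefficients of the powers of \<open>x\<^sub>1\<^sup>2\<close> in the
discriminant of a cubic with coefficients \<open>c\<close>, \<open>x\<^sub>1\<^sup>2 + m\<close>, \<open>b x\<^sub>1\<^sup>2 + l\<close> and \<open>d\<close>.\<close>

lemma edge_form_monic:
  obtains L where "x1deg_less 8 L" "\<And>x. edge_form a b x = b^2 * (x $ 1) ^ 8 + L x"
proof -
  define c where "c x = (x $ 4)^2" for x :: "complex^4"
  define d where "d x = a * b * (x $ 3)^2" for x :: "complex^4"
  define m where "m x = (x $ 2)^2 + (x $ 3)^2 + (a + b) * (x $ 4)^2" for x :: "complex^4"
  define l where "l x = a * (x $ 2)^2 + (a + b) * (x $ 3)^2 + a * b * (x $ 4)^2" for x :: "complex^4"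
  define f3 where "f3 x = 2 * b * l x + 2 * m x * b^2 - 4 * c x * b^3 - 4 * d x" for x
  define f2 where "f2 x = l x^2 + 4 * b * m x * l x + m x^2 * b^2 - 12 * c x * b^2 * l x - 12 * d x * m x + 18 * c x * d x * b" for x
  define f1 where "f1 x = 2 * m x * l x^2 + 2 * m x^2 * b * l x - 12 * c x * b * l x^2 - 12 * d x * m x^2 + 18 * c x * d x * (l x + m x * b)" for x
  define f0 where "f0 x = m x^2 * l x^2 - 4 * c x * l x^3 - 4 * m x^3 * d x + 18 * c x * d x * m x * l x - 27 * c x^2 * d x^2" for x
  define L where "L x = f3 x * (x $ 1)^6 + f2 x * (x $ 1)^4 + f1 x * (x $ 1)^2 + f0 x * (x $ 1)^0" for x
  have free: "x1free c" "x1free d" "x1free m" "x1free l"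
    unfolding c_def d_def m_def l_def
    by (intro x1free_add x1free_mult x1free_power x1free_const x1free_coord; simp)+
  have "x1free f3" "x1free f2" "x1free f1" "x1free f0"
    unfolding f3_def f2_def f1_def f0_def
    by (intro x1free_add x1free_diff x1free_mult x1free_power x1free_const free)+
  then have "x1deg_less 8 L" unfolding L_def
    by (intro x1deg_less_add x1deg_less_monomial) auto
  moreover have "edge_form a b x = b^2 * (x $ 1) ^ 8 + L x" for x
  proof -
    have "edge_form a b x = cubic_discriminant (c x) ((x $ 1)^2 + m x) (b * (x $ 1)^2 + l x) (d x)"
      by (simp add: edge_form_def c_def d_def m_def l_def add.assoc)
    also have "\<dots> = b^2 * (x $ 1) ^ 8 + L x"
      unfolding cubic_discriminant_def L_def f3_def f2_def f1_def f0_def by algebra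
    finally show ?thesis .
  qed
  ultimately show ?thesis using that by blast
qed

lemma rsquarefree_card_roots:
  fixes p :: "complex poly"
  assumes "p \<noteq> 0" "\<And>z. poly p z = 0 \<Longrightarrow> poly (pderiv p) z \<noteq> 0"
  shows "card {z. poly p z = 0} = Polynomial.degree p"
proof -
  have "rsquarefree p" using assms(2) by (auto simp: rsquarefree_roots)
  then have p: "p = smult (lead_coeff p) (\<Prod>z|poly p z = 0. [:-z, 1:])"
    using complex_poly_decompose_rsquarefree by metis
  have "Polynomial.degree p = Polynomial.degree (\<Prod>z|poly p z = 0. [:-z, 1:])"
    using assms(1) by (subst p) simp
  also have "\<dots> = (\<Sum>z|poly p z = 0. 1)"
    by (subst degree_prod_eq_sum_degree) auto
  finally show ?thesis by simp
qed

text \<open>With \<open>\<tau> = t / s\<close>, the equations \<open>u\<^sup>2 + v\<^sup>2 + z\<^sup>2 = 0\<close> and \<open>a u\<^sup>2 + b v\<^sup>2 + (w / \<tau>)\<^sup>2 = 0\<close> are linear in \<open>u\<^sup>2\<close>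
and \<open>v\<^sup>2\<close>; the last two hypotheses are their solution, multiplied out.\<close>

lemma edge_cone_memI:
  assumes "a \<noteq> b" "\<tau> \<noteq> 0" "1 + a * \<tau> \<noteq> 0" "1 + b * \<tau> \<noteq> 0" "z \<noteq> 0"
    and x: "(a - b) * x^2 * \<tau>^2 = (b * z^2 * \<tau>^2 - w^2) * (1 + a * \<tau>)^2"
    and y: "(b - a) * y^2 * \<tau>^2 = (a * z^2 * \<tau>^2 - w^2) * (1 + b * \<tau>)^2"
  shows "vector [x, y, z, w] \<in> edge_cone a b"
proof -
  define u where "u = x / (1 + a * \<tau>)"
  define v where "v = y / (1 + b * \<tau>)"
  have xy: "x = (1 + a * \<tau>) * u" "y = (1 + b * \<tau>) * v"
    using assms by (simp_all add: u_def v_def)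
  have "(1 + a * \<tau>)^2 * ((a - b) * u^2 * \<tau>^2) = (1 + a * \<tau>)^2 * (b * z^2 * \<tau>^2 - w^2)"
    using x unfolding xy by (simp add: power_mult_distrib mult_ac)
  then have u: "(a - b) * u^2 * \<tau>^2 = b * z^2 * \<tau>^2 - w^2" using assms(3) by simp
  have "(1 + b * \<tau>)^2 * ((b - a) * v^2 * \<tau>^2) = (1 + b * \<tau>)^2 * (a * z^2 * \<tau>^2 - w^2)"
    using y unfolding xy by (simp add: power_mult_distrib mult_ac)
  then have v: "(b - a) * v^2 * \<tau>^2 = a * z^2 * \<tau>^2 - w^2" using assms(4) by simp
  have "(a - b) * \<tau>^2 * (u^2 + v^2 + z^2) = 0" using u v by algebra
  then have 1: "u^2 + v^2 + z^2 = 0" using assms(1,2) by simp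
  have "(a - b) * \<tau>^2 * (a * u^2 + b * v^2 + (w / \<tau>)^2) = a * ((a - b) * u^2 * \<tau>^2) - b * ((b - a) * v^2 * \<tau>^2) + (a - b) * w^2"
    using assms(2) by (simp add: field_simps)
  also have "\<dots> = 0" unfolding u v by algebra
  finally have 2: "a * u^2 + b * v^2 + (w / \<tau>)^2 = 0" using assms(1,2) by simp
  have "u \<noteq> 0 \<or> v \<noteq> 0" using 1 assms(5) by auto
  have "vector [x, y, z, w] = (vector [(1 + \<tau> * a) * u, (1 + \<tau> * b) * v, 1 * z, \<tau> * (w / \<tau>)] :: complex^4)"
    using assms(2) by (simp add: xy mult.commute)
  then show ?thesis unfolding edge_cone_def using 1 2 \<open>u \<noteq> 0 \<or> v \<noteq> 0\<close> by blast
qed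

text \<open>Under the equations of the preceding lemma (for the squares of the coordinates), the cubic whose
discriminant is the edge form has the double root \<open>S = 1\<close>, \<open>T = \<tau>\<close>.\<close>

lemma double_root_of_cubic:
  fixes \<xi> :: complex
  assumes "a \<noteq> b" "\<tau> \<noteq> 0"
    and x: "(a - b) * \<xi> * \<tau>^2 = (b * \<zeta> * \<tau>^2 - \<omega>) * (1 + a * \<tau>)^2"
    and y: "(b - a) * \<eta> * \<tau>^2 = (a * \<zeta> * \<tau>^2 - \<omega>) * (1 + b * \<tau>)^2"
  shows "\<omega> + (\<xi> + \<eta> + \<zeta> + (a + b) * \<omega>) * \<tau> + (b * \<xi> + a * \<eta> + (a + b) * \<zeta> + a * b * \<omega>) * \<tau>^2
           + a * b * \<zeta> * \<tau>^3 = 0" (is "?p = 0")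
    and "(\<xi> + \<eta> + \<zeta> + (a + b) * \<omega>) + 2 * (b * \<xi> + a * \<eta> + (a + b) * \<zeta> + a * b * \<omega>) * \<tau>
           + 3 * a * b * \<zeta> * \<tau>^2 = 0" (is "?p' = 0")
proof -
  have "(a - b) * \<tau>^2 * ?p = 0" using x y by algebra
  then show "?p = 0" using assms(1,2) by simp
  have "(a - b) * \<tau>^2 * ?p' = 0" using x y by algebra
  then show "?p' = 0" using assms(1,2) by simp
qed

text \<open>The divided difference of a cubic at two double nodes is its leading coefficient; at two double roots it
vanishes. The identity in the proof is this divided difference with denominators cleared.\<close>

lemma double_root_unique:
  fixes c0 :: complex
  assumes "c0 + c1 * \<sigma> + c2 * \<sigma>^2 + c3 * \<sigma>^3 = 0" "c1 + 2 * c2 * \<sigma> + 3 * c3 * \<sigma>^2 = 0"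
    and "c0 + c1 * \<tau> + c2 * \<tau>^2 + c3 * \<tau>^3 = 0" "c1 + 2 * c2 * \<tau> + 3 * c3 * \<tau>^2 = 0"
    and "c3 \<noteq> 0"
  shows "\<sigma> = \<tau>"
proof -
  have "c3 * (\<sigma> - \<tau>)^3 = (\<sigma> - \<tau>) * ((c1 + 2 * c2 * \<sigma> + 3 * c3 * \<sigma>^2) + (c1 + 2 * c2 * \<tau> + 3 * c3 * \<tau>^2))
      - 2 * ((c0 + c1 * \<sigma> + c2 * \<sigma>^2 + c3 * \<sigma>^3) - (c0 + c1 * \<tau> + c2 * \<tau>^2 + c3 * \<tau>^3))"
    by algebra
  then have "c3 * (\<sigma> - \<tau>)^3 = 0" unfolding assms(1-4) by simp
  then show ?thesis using assms(5) by simp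
qed

text \<open>For given \<open>y\<close>, \<open>z\<close>, \<open>w\<close>, the second equation in \<open>edge_cone_memI\<close> is a quartic \<open>A - (b - a) y\<^sup>2 \<tau>\<^sup>2\<close> in
\<open>\<tau>\<close>, and the first one then gives \<open>x\<^sup>2\<close>. A multiple root of the quartic satisfies
\<open>\<tau> A' = 2 A\<close>, an equation that does not involve \<open>y\<close>; so only finitely many \<open>\<tau>\<close>, and hence finitely
many \<open>y\<close>, have to be excluded in order to get four simple roots. The values of \<open>x\<^sup>2\<close> at different
roots differ because \<open>double_root_of_cubic\<close> makes every root a double root of the same cubic.\<close>

lemma edge_cone_fibre:
  assumes "a \<noteq> 0" "b \<noteq> 0" "a \<noteq> b" "z \<noteq> 0" "w \<noteq> 0"
  obtains Y where "finite Y"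
    "\<And>y. y \<notin> Y \<Longrightarrow> \<exists>S. card S = 8 \<and> (\<forall>x\<in>S. vector [x, y, z, w] \<in> edge_cone a b)"
proof -
  define A where "A = [:- (w^2), 0, a * z^2:] * [:1, b:]^2"
  have A: "poly A \<tau> = (a * z^2 * \<tau>^2 - w^2) * (1 + b * \<tau>)^2" for \<tau>
    by (simp add: A_def power2_eq_square algebra_simps)
  have A_expand: "A = [:- (w^2), - 2 * b * w^2, a * z^2 - b^2 * w^2, 2 * a * b * z^2, a * b^2 * z^2:]"
    by (simp add: A_def power2_eq_square algebra_simps)
  define B where "B = [:0, 1:] * pderiv A - smult 2 A"
  have "coeff B 0 = 2 * w^2" by (simp add: B_def A_expand)
  then have "B \<noteq> 0" using assms(5) by auto
  define T where "T = {\<tau>. poly B \<tau> = 0} \<union> {\<tau>. poly [:1, a:] \<tau> = 0} \<union> {\<tau>. poly [:1, b:] \<tau> = 0}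
    \<union> {\<tau>. poly [:- (w^2), 0, b * z^2:] \<tau> = 0}"
  have "finite T" unfolding T_def using \<open>B \<noteq> 0\<close> assms
    by (intro finite_UnI poly_roots_finite) auto
  define Y where "Y = (\<Union>\<tau>\<in>T - {0}. {y. poly [:- (poly A \<tau>), 0, (b - a) * \<tau>^2:] y = 0})"
  have "finite Y" unfolding Y_def using \<open>finite T\<close> assms(3)
    by (intro finite_UN_I poly_roots_finite) auto
  moreover have "\<exists>S. card S = 8 \<and> (\<forall>x\<in>S. vector [x, y, z, w] \<in> edge_cone a b)" if "y \<notin> Y" for y
  proof -
    define P where "P = A - [:0, 0, (b - a) * y^2:]"
    have P: "poly P \<tau> = 0 \<longleftrightarrow> (b - a) * y^2 * \<tau>^2 = poly A \<tau>" for \<tau>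
      by (auto simp: P_def power2_eq_square algebra_simps)
    have degP: "Polynomial.degree P = 4" and "P \<noteq> 0" using assms by (simp_all add: P_def A_expand)
    have root: "\<tau> \<noteq> 0 \<and> \<tau> \<notin> T" if "poly P \<tau> = 0" for \<tau>
    proof -
      have "\<tau> \<noteq> 0" using that P [of \<tau>] A [of \<tau>] assms(5) by auto
      moreover have "poly [:- (poly A \<tau>), 0, (b - a) * \<tau>^2:] y = 0"
        using that P [of \<tau>] by (simp add: power2_eq_square algebra_simps)
      ultimately show ?thesis using \<open>y \<notin> Y\<close> unfolding Y_def by blast
    qed
    have simple: "poly (pderiv P) \<tau> \<noteq> 0" if "poly P \<tau> = 0" for \<tau>
    proof
      assume "poly (pderiv P) \<tau> = 0"
      then have "poly (pderiv A) \<tau> = 2 * (b - a) * y^2 * \<tau>"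
        by (simp add: P_def pderiv_diff pderiv_pCons)
      moreover have "(b - a) * y^2 * \<tau>^2 = poly A \<tau>" using that P by blast
      ultimately have "\<tau> * poly (pderiv A) \<tau> = 2 * poly A \<tau>" by algebra
      then have "poly B \<tau> = 0" by (simp add: B_def)
      then show False using root [OF that] by (simp add: T_def)
    qed
    let ?R = "{\<tau>. poly P \<tau> = 0}"
    have cardR: "card ?R = 4"
      using rsquarefree_card_roots [OF \<open>P \<noteq> 0\<close> simple] degP by simp
    define g where "g \<tau> = (b * z^2 * \<tau>^2 - w^2) * (1 + a * \<tau>)^2 / ((a - b) * \<tau>^2)" for \<tau>
    have g: "(a - b) * g \<tau> * \<tau>^2 = (b * z^2 * \<tau>^2 - w^2) * (1 + a * \<tau>)^2"
      and y: "(b - a) * y^2 * \<tau>^2 = (a * z^2 * \<tau>^2 - w^2) * (1 + b * \<tau>)^2"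
      and nz: "\<tau> \<noteq> 0" "1 + a * \<tau> \<noteq> 0" "1 + b * \<tau> \<noteq> 0" "g \<tau> \<noteq> 0" if "\<tau> \<in> ?R" for \<tau>
    proof -
      show "\<tau> \<noteq> 0" using root that by blast
      then show "(a - b) * g \<tau> * \<tau>^2 = (b * z^2 * \<tau>^2 - w^2) * (1 + a * \<tau>)^2"
        using assms(3) by (simp add: g_def)
      show "(b - a) * y^2 * \<tau>^2 = (a * z^2 * \<tau>^2 - w^2) * (1 + b * \<tau>)^2"
        using that P A by simp
      have "\<tau> \<notin> T" using root that by blast
      then show "1 + a * \<tau> \<noteq> 0" "1 + b * \<tau> \<noteq> 0"
        by (auto simp: T_def mult.commute)
      moreover have "b * z^2 * \<tau>^2 - w^2 \<noteq> 0" using \<open>\<tau> \<notin> T\<close>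
        by (auto simp: T_def power2_eq_square algebra_simps)
      ultimately show "g \<tau> \<noteq> 0" using \<open>\<tau> \<noteq> 0\<close> assms(3) by (simp add: g_def)
    qed
    have inj: "\<sigma> = \<tau>" if "\<sigma> \<in> ?R" "\<tau> \<in> ?R" "g \<sigma> = g \<tau>" for \<sigma> \<tau>
    proof -
      note s = double_root_of_cubic [OF \<open>a \<noteq> b\<close> nz(1) [OF that(1)] g [OF that(1)] y [OF that(1)]]
      note t = double_root_of_cubic [OF \<open>a \<noteq> b\<close> nz(1) [OF that(2)] g [OF that(2)] y [OF that(2)],
          folded that(3)]
      have "a * b * z^2 \<noteq> 0" using assms by simp
      then show ?thesis
        using double_root_unique [OF s(1) _ t(1)] s(2) t(2) by (simp add: mult.assoc)
    qed
    \<comment> \<open>Both square roots of \<open>g \<tau>\<close>, for each of the four roots.\<close>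
    define S where "S = (\<lambda>(\<tau>, e). e * csqrt (g \<tau>)) ` (?R \<times> {1, - 1})"
    have sq: "(e * csqrt (g \<tau>))^2 = g \<tau>" if "e \<in> {1, - 1}" for e \<tau>
      using that by (auto simp: power_mult_distrib)
    have "inj_on (\<lambda>(\<tau>, e). e * csqrt (g \<tau>)) (?R \<times> {1, - 1})"
    proof (rule inj_onI, clarify)
      fix \<sigma> \<tau> e f assume *: "poly P \<sigma> = 0" "poly P \<tau> = 0" "e \<in> {1, - 1}" "f \<in> {1, - 1 :: complex}"
        and eq: "e * csqrt (g \<sigma>) = f * csqrt (g \<tau>)"
      have "g \<sigma> = g \<tau>" using sq [OF *(3), of \<sigma>] sq [OF *(4), of \<tau>] eq by simp
      then have "\<sigma> = \<tau>" using inj * by blast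
      then show "\<sigma> = \<tau> \<and> e = f" using eq nz(4) [of \<tau>] * by simp
    qed
    then have "card S = card (?R \<times> {1, - 1 :: complex})" unfolding S_def by (rule card_image)
    also have "\<dots> = 8" by (simp add: card_cartesian_product cardR)
    finally have "card S = 8" .
    moreover have "vector [x, y, z, w] \<in> edge_cone a b" if xS: "x \<in> S" for x
    proof -
      from xS obtain q where q: "q \<in> ?R \<times> {1, - 1}" "x = (case q of (\<tau>, e) \<Rightarrow> e * csqrt (g \<tau>))"
        unfolding S_def by (rule imageE)
      obtain \<tau> e where "q = (\<tau>, e)" by (rule prod.exhaust)
      then have \<tau>: "\<tau> \<in> ?R" and e: "e \<in> {1, - 1}" "x = e * csqrt (g \<tau>)"
        using q by (simp_all only: mem_Sigma_iff prod.case)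
      have "x^2 = g \<tau>" using sq [OF e(1)] e(2) by simp
      then show ?thesis
        using g [OF \<tau>(1)] y [OF \<tau>(1)] nz [OF \<tau>(1)] assms
        by (intro edge_cone_memI [of a b \<tau>]) auto
    qed
    ultimately show ?thesis by blast
  qed
  ultimately show ?thesis using that by blast
qed

text \<open>The coefficients of the remainder vanish wherever \<open>edge_cone_fibre\<close> applies, because a polynomial of
degree less than eight with eight zeros is zero. The exceptional points are removed one coordinate at a
time, as a polynomial vanishing at all but finitely many points of a line vanishes on the line.\<close>

lemma edge_form_divides:
  assumes ab: "a \<noteq> 0" "b \<noteq> 0" "a \<noteq> b" and "polyfun G"
    and van: "\<And>x. x \<in> edge_cone a b \<Longrightarrow> G x = 0"
  obtains Q where "polyfun Q" "\<And>x. G x = edge_form a b x * Q x"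
proof -
  obtain L where "x1deg_less 8 L" "\<And>x. edge_form a b x = b^2 * (x $ 1) ^ 8 + L x"
    by (rule edge_form_monic) (rule that)
  then obtain Q R where Q: "polyfun Q" and R: "x1deg_less 8 R" and G: "\<And>x. G x = edge_form a b x * Q x + R x"
    using monic_division [of "edge_form a b" "b^2" 8 L G] \<open>polyfun G\<close> \<open>b \<noteq> 0\<close> by auto
  obtain r where r: "\<And>i. x1free (r i)" "\<And>x. R x = (\<Sum>i<8. r i x * (x $ 1) ^ i)"
    using R by (auto simp: x1deg_less_def)
  have poly_r: "polyfun (r i)" for i using r(1) by (simp add: x1free_def)
  have van_R: "R x = 0" if "x \<in> edge_cone a b" for x
    using van [OF that] G [of x] edge_form_vanishes [OF that] by simp
  have generic: "r i x = 0"
    if "i < 8" "card S = 8" and S: "\<And>t. t \<in> S \<Longrightarrow> vector [t, x $ 2, x $ 3, x $ 4] \<in> edge_cone a b" for i x S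
  proof -
    define p where "p = (\<Sum>i<8. Polynomial.monom (r i x) i)"
    have coeff: "coeff p i = (if i < 8 then r i x else 0)" for i
      by (simp add: p_def coeff_sum)
    have "poly p t = 0" if "t \<in> S" for t
    proof -
      have x: "vector [t, x $ 2, x $ 3, x $ 4] = x + (t - x $ 1) *s axis 1 1"
        by (simp add: vec_eq_iff forall_4 axis_def)
      have "r i (vector [t, x $ 2, x $ 3, x $ 4]) = r i x" for i
        unfolding x using r(1) [of i] unfolding x1free_def by blast
      then show ?thesis
        using van_R [OF S [OF that]] by (simp add: r(2) p_def poly_sum poly_monom)
    qed
    then have sub: "S \<subseteq> {t. poly p t = 0}" by blast
    have "p = 0"
    proof (rule ccontr)
      assume "p \<noteq> 0"
      then have "Polynomial.degree p < 8"
        using coeff [of "Polynomial.degree p"] by (auto split: if_splits)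
      moreover have "8 \<le> card {t. poly p t = 0}"
        using card_mono [OF poly_roots_finite [OF \<open>p \<noteq> 0\<close>] sub] \<open>card S = 8\<close> by simp
      ultimately show False using card_poly_roots_bound [OF \<open>p \<noteq> 0\<close>] by linarith
    qed
    then show ?thesis using coeff [of i] \<open>i < 8\<close> by simp
  qed
  have step2: "r i x = 0" if "i < 8" and x34: "x $ 3 \<noteq> 0" "x $ 4 \<noteq> 0" for i x
  proof -
    obtain Y where Y: "finite Y"
      "\<And>y. y \<notin> Y \<Longrightarrow> \<exists>S. card S = 8 \<and> (\<forall>t\<in>S. vector [t, y, x $ 3, x $ 4] \<in> edge_cone a b)"
      by (rule edge_cone_fibre [OF ab x34]) (rule that)
    have "r i (x + t *s axis 2 1) = 0" if "t \<notin> (\<lambda>y. y - x $ 2) ` Y" for t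
    proof -
      let ?x = "x + t *s axis 2 1"
      have x: "?x $ 2 = x $ 2 + t" "?x $ 3 = x $ 3" "?x $ 4 = x $ 4"
        by (simp_all add: axis_def)
      have "?x $ 2 \<notin> Y" using that unfolding x by force
      then obtain S where "card S = 8" "\<forall>t\<in>S. vector [t, ?x $ 2, ?x $ 3, ?x $ 4] \<in> edge_cone a b"
        using Y(2) [of "?x $ 2"] unfolding x by blast
      then show ?thesis using generic [OF \<open>i < 8\<close>] by blast
    qed
    then show ?thesis using polyfun_eq_zero_cofinite [OF poly_r] Y(1) by (metis finite_imageI)
  qed
  have step3: "r i x = 0" if "i < 8" "x $ 4 \<noteq> 0" for i x
  proof -
    have "r i (x + t *s axis 3 1) = 0" if "t \<notin> {- (x $ 3)}" for t
      using that \<open>i < 8\<close> \<open>x $ 4 \<noteq> 0\<close> by (intro step2) (auto simp: axis_def add_eq_0_iff)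
    then show ?thesis using polyfun_eq_zero_cofinite [OF poly_r, of "{- (x $ 3)}"] by blast
  qed
  have "r i x = 0" if "i < 8" for i x
  proof -
    have "r i (x + t *s axis 4 1) = 0" if "t \<notin> {- (x $ 4)}" for t
      using that \<open>i < 8\<close> by (intro step3) (auto simp: axis_def add_eq_0_iff)
    then show ?thesis using polyfun_eq_zero_cofinite [OF poly_r, of "{- (x $ 4)}"] by blast
  qed
  then have "R x = 0" for x by (simp add: r(2))
  then show ?thesis using that Q G by simp
qed

section \<open>Conics and their tangent lines\<close>

lemma P3_iff: "P \<in> P3 \<longleftrightarrow> (\<exists>x. x \<noteq> 0 \<and> P = vec.span {x})"
proof
  assume "P \<in> P3"
  then have P: "vec.subspace P" "vec.dim P = 1" by (auto simp: P3_def)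
  obtain x where x: "x \<in> P" "x \<noteq> 0"
    using P(2) vec.dim_eq_0 [of P] by auto
  have "vec.span {x} = P"
    using P x by (intro vec.subspace_dim_equal vec.subspace_span vec.span_minimal) auto
  then show "\<exists>x. x \<noteq> 0 \<and> P = vec.span {x}" using x by blast
qed (auto simp: P3_def)

lemma span_singleton_iff: "y \<in> vec.span {x :: complex^4} \<longleftrightarrow> (\<exists>c. y = c *s x)"
  by (auto simp: vec.span_singleton)

definition symmetric_bilinear :: "(complex^4 \<Rightarrow> complex^4 \<Rightarrow> complex) \<Rightarrow> bool" where
  "symmetric_bilinear B \<longleftrightarrow> (\<forall>x y. B x y = B y x) \<and> (\<forall>x y z. B (x + y) z = B x z + B y z)
     \<and> (\<forall>c x z. B (c *s x) z = c * B x z)"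

lemma symmetric_bilinear_commute: "symmetric_bilinear B \<Longrightarrow> B x y = B y x"
  unfolding symmetric_bilinear_def by blast

lemma symmetric_bilinear_simps:
  assumes "symmetric_bilinear B"
  shows "B (x + y) z = B x z + B y z" "B z (x + y) = B z x + B z y"
    "B (c *s x) z = c * B x z" "B z (c *s x) = c * B z x"
    "B (x - y) z = B x z - B y z" "B z (x - y) = B z x - B z y"
    "B 0 z = 0" "B z 0 = 0"
proof -
  show 1: "B (x + y) z = B x z + B y z" "B (c *s x) z = c * B x z" for x y z c
    using assms by (auto simp: symmetric_bilinear_def)
  then show "B z (x + y) = B z x + B z y" "B z (c *s x) = c * B z x"
    using symmetric_bilinear_commute [OF assms, of z] by simp_all
  show 2: "B (x - y) z = B x z - B y z" for x y z
  proof -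
    have "x - y = x + (- 1) *s y" by (simp add: vec_eq_iff)
    then show ?thesis by (simp only: 1) simp
  qed
  then show "B z (x - y) = B z x - B z y"
    using symmetric_bilinear_commute [OF assms, of z] by simp
  show "B 0 z = 0" using 1(2) [of 0 0 z] by simp
  then show "B z 0 = 0" using symmetric_bilinear_commute [OF assms, of z] by simp
qed

text \<open>The data behind a smooth conic: the linear subspace \<open>W\<close> of its plane and the polar form \<open>B\<close> of its
equation. Smoothness becomes the condition that no nonzero isotropic vector in \<open>W\<close> is orthogonal to \<open>W\<close>.\<close>

definition is_conic :: "point set \<Rightarrow> (complex^4) set \<Rightarrow> (complex^4 \<Rightarrow> complex^4 \<Rightarrow> complex) \<Rightarrow> bool" where
  "is_conic C W B \<longleftrightarrow> vec.subspace W \<and> vec.dim W = 3 \<and> symmetric_bilinear B \<and> polyfun (\<lambda>x. B x x)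
     \<and> C = {P \<in> projectivization W. \<forall>x\<in>P. B x x = 0}
     \<and> (\<forall>x\<in>W. x \<noteq> 0 \<longrightarrow> B x x = 0 \<longrightarrow> (\<exists>v\<in>W. B x v \<noteq> 0))"

lemma exponents_of_degree_two:
  fixes e :: "'i::finite \<Rightarrow> nat"
  assumes "sum e UNIV = 2"
  obtains i j where "\<And>x :: 'i \<Rightarrow> complex. (\<Prod>k\<in>UNIV. x k ^ e k) = x i * x j"
proof -
  have split: "(\<Prod>k\<in>UNIV. x k ^ e k) = x i * (\<Prod>k\<in>UNIV. x k ^ (e(i := n)) k)"
      "sum e UNIV = Suc (sum (e(i := n)) UNIV)"
    if "e i = Suc n" for x :: "'i \<Rightarrow> complex" and e :: "'i \<Rightarrow> nat" and i n
  proof -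
    show "(\<Prod>k\<in>UNIV. x k ^ e k) = x i * (\<Prod>k\<in>UNIV. x k ^ (e(i := n)) k)"
      using that by (simp add: prod.remove [of UNIV i] mult.assoc)
    show "sum e UNIV = Suc (sum (e(i := n)) UNIV)"
      using that by (simp add: sum.remove [of UNIV i])
  qed
  have "\<exists>i n. e i = Suc n" if "sum e UNIV \<noteq> 0" for e :: "'i \<Rightarrow> nat"
    using that by (meson not0_implies_Suc sum.neutral)
  then obtain i n where i: "e i = Suc n" using assms by fastforce
  then have "sum (e(i := n)) UNIV = 1" using split(2) [of e i n] assms by simp
  then obtain j m where j: "(e(i := n)) j = Suc m"
    using \<open>\<And>e. sum e UNIV \<noteq> 0 \<Longrightarrow> \<exists>i n. e i = Suc n\<close> by (metis one_neq_zero)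
  then have "sum ((e(i := n))(j := m)) UNIV = 0" using split(2) [of "e(i := n)" j m] j \<open>sum (e(i := n)) UNIV = 1\<close> by simp
  then have "((e(i := n))(j := m)) k = 0" for k by simp
  then have "(\<Prod>k\<in>UNIV. x k ^ e k) = x i * x j" for x :: "'i \<Rightarrow> complex"
    unfolding split(1) [of e i n, OF i] split(1) [of "e(i := n)" j m, OF j] by simp
  then show ?thesis using that by blast
qed

text \<open>Every monomial of degree two is a product of two coordinates, and such a product is polarized
directly.\<close>

lemma quadratic_form_polarization:
  assumes "homogeneous4 2 q"
  obtains B where "symmetric_bilinear B" "\<And>x. eval4 q x = B x x"
proof -
  have "\<exists>i j. \<forall>x :: complex^4. (\<Prod>k\<in>UNIV. (x $ k) ^ Poly_Mapping.lookup m k) = x $ i * x $ j"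
    if "m \<in> Poly_Mapping.keys q" for m
  proof -
    have "sum (Poly_Mapping.lookup m) UNIV = 2" using assms that by (simp add: homogeneous4_def)
    then obtain i j where "\<And>x :: 4 \<Rightarrow> complex. (\<Prod>k\<in>UNIV. x k ^ Poly_Mapping.lookup m k) = x i * x j"
      by (rule exponents_of_degree_two) (rule that)
    then show ?thesis by blast
  qed
  then obtain i j where ij: "\<And>m x. m \<in> Poly_Mapping.keys q
      \<Longrightarrow> (\<Prod>k\<in>UNIV. ((x :: complex^4) $ k) ^ Poly_Mapping.lookup m k) = x $ i m * x $ j m"
    by metis
  define B where "B x y = (\<Sum>m\<in>Poly_Mapping.keys q. Poly_Mapping.lookup q m / 2 * (x $ i m * y $ j m + x $ j m * y $ i m))"
    for x y :: "complex^4"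
  have "symmetric_bilinear B"
    unfolding symmetric_bilinear_def B_def
    by (auto simp: algebra_simps add_divide_distrib sum_distrib_left simp flip: sum.distrib intro!: sum.cong)
  moreover have "eval4 q x = B x x" for x
    unfolding eval4_def B_def by (intro sum.cong) (auto simp: ij)
  ultimately show ?thesis using that by blast
qed

lemma smooth_conic_is_conic:
  assumes "smooth_conic C"
  obtains W B where "is_conic C W B"
proof -
  obtain W q where W: "vec.subspace W" "vec.dim W = 3" and q: "homogeneous4 2 q"
    and C: "C = {P \<in> projectivization W. vanishes_at q P}"
    and smooth: "\<And>P x. P \<in> C \<Longrightarrow> x \<in> P - {0} \<Longrightarrow> \<exists>v\<in>W. differential4 q x v \<noteq> 0"
    using assms unfolding smooth_conic_def by blast
  obtain B where B: "symmetric_bilinear B" and qB: "\<And>x. eval4 q x = B x x"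
    by (rule quadratic_form_polarization [OF q]) (rule that)
  have diff: "differential4 q x v = 2 * B x v" for x v
  proof -
    have "((\<lambda>t. B x x + 2 * B x v * t + B v v * t^2) has_field_derivative 2 * B x v) (at 0)"
      by (auto intro!: derivative_eq_intros)
    then show ?thesis unfolding differential4_def qB
      by (intro DERIV_imp_deriv)
        (simp add: symmetric_bilinear_simps [OF B] symmetric_bilinear_commute [OF B, of v x] algebra_simps power2_eq_square)
  qed
  have "polyfun (\<lambda>x. B x x)" using polyfun_eval4 [of q] by (simp add: qB [symmetric] polyfunI)
  moreover have "\<exists>v\<in>W. B x v \<noteq> 0" if "x \<in> W" "x \<noteq> 0" "B x x = 0" for x
  proof -
    have "vec.span {x} \<subseteq> W" using that W by (intro vec.span_minimal) auto
    moreover have "vec.span {x} \<in> P3" using that P3_iff by blast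
    ultimately have "vec.span {x} \<in> C" using that(3) unfolding C
      by (auto simp: projectivization_def vanishes_at_def qB span_singleton_iff symmetric_bilinear_simps [OF B])
    moreover have "x \<in> vec.span {x} - {0}" using that by (auto intro: vec.span_base)
    ultimately show ?thesis using smooth diff by fastforce
  qed
  ultimately show ?thesis using that [of W B] W B C
    unfolding is_conic_def by (auto simp: vanishes_at_def qB)
qed

lemma conic_memI:
  assumes "is_conic C W B" "x \<in> W" "x \<noteq> 0" "B x x = 0"
  shows "vec.span {x} \<in> C"
proof -
  have B: "symmetric_bilinear B" and W: "vec.subspace W"
    and C: "C = {P \<in> projectivization W. \<forall>x\<in>P. B x x = 0}" using assms(1) by (auto simp: is_conic_def)
  have "vec.span {x} \<subseteq> W" using assms W by (intro vec.span_minimal) auto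
  then show ?thesis using assms P3_iff unfolding C
    by (auto simp: projectivization_def span_singleton_iff symmetric_bilinear_simps [OF B])
qed

lemma conic_memD:
  assumes "is_conic C W B" "P \<in> C"
  obtains x where "P = vec.span {x}" "x \<in> W" "x \<noteq> 0" "B x x = 0"
proof -
  have "P \<in> P3" "P \<subseteq> W" "\<forall>x\<in>P. B x x = 0"
    using assms by (auto simp: is_conic_def projectivization_def)
  then obtain x where x: "x \<noteq> 0" "P = vec.span {x}" using P3_iff by blast
  then have "x \<in> P" by (simp add: vec.span_base)
  then show ?thesis using that x \<open>P \<subseteq> W\<close> \<open>\<forall>x\<in>P. B x x = 0\<close> by blast
qed

text \<open>On two independent vectors the form is a binary quadratic form, which has a zero by the quadratic
formula.\<close>

lemma isotropic_vector_exists: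
  assumes B: "symmetric_bilinear B" and S: "vec.subspace S" "vec.dim S \<ge> 2"
  obtains x where "x \<in> S" "x \<noteq> 0" "B x x = 0"
proof -
  obtain f where f: "f \<in> S" "f \<noteq> 0" using S(2) vec.dim_eq_0 [of S] by fastforce
  have "\<not> S \<subseteq> vec.span {f}" using vec.dim_mono [of S "{f}"] S(2) f(2) by auto
  then obtain g where g: "g \<in> S" "g \<notin> vec.span {f}" by blast
  show ?thesis
  proof (cases "B f f = 0")
    case False
    define t where "t = (- B f g + csqrt ((B f g)^2 - B g g * B f f)) / B f f"
    have "B f f * (B g g + 2 * t * B f g + t^2 * B f f) = (B f f * t + B f g)^2 - ((B f g)^2 - B g g * B f f)"
      by (simp add: power2_eq_square algebra_simps)
    also have "B f f * t + B f g = csqrt ((B f g)^2 - B g g * B f f)"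
      using False by (simp add: t_def)
    finally have "B g g + 2 * t * B f g + t^2 * B f f = 0" using False by simp
    then have "B (g + t *s f) (g + t *s f) = 0"
      using symmetric_bilinear_commute [OF B, of g f]
      by (simp add: symmetric_bilinear_simps [OF B] power2_eq_square algebra_simps)
    moreover have "g + t *s f \<noteq> 0"
    proof
      assume "g + t *s f = 0"
      then have "g = (- t) *s f" by (simp add: add_eq_0_iff)
      then show False using g(2) span_singleton_iff by blast
    qed
    moreover have "g + t *s f \<in> S"
      using S(1) f g by (intro vec.subspace_add vec.subspace_scale)
    ultimately show ?thesis using that by blast
  qed (use that f in blast)
qed

text \<open>An isotropic vector \<open>x\<close> pairs nontrivially with some \<open>v\<close> in \<open>W\<close>, and a multiple of \<open>x\<close> can be subtracted
from \<open>v\<close> to make it isotropic. Such a \<open>y\<close> is used to correct a vector to an isotropic one.\<close>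

lemma hyperbolic_partner:
  assumes C: "is_conic C W B" and x: "x \<in> W" "x \<noteq> 0" "B x x = 0"
  obtains y where "y \<in> W" "B y y = 0" "2 * B x y = 1"
proof -
  have B: "symmetric_bilinear B" and W: "vec.subspace W" using C by (auto simp: is_conic_def)
  obtain v where v: "v \<in> W" "B x v \<noteq> 0" using C x unfolding is_conic_def by blast
  define v' where "v' = v - (B v v / (2 * B x v)) *s x"
  define y where "y = (1 / (2 * B x v)) *s v'"
  have "B x v' = B x v" "B v' v' = 0"
    using v x symmetric_bilinear_commute [OF B, of v x]
    by (simp_all add: v'_def symmetric_bilinear_simps [OF B])
  then have "B y y = 0" "2 * B x y = 1" using v by (simp_all add: y_def symmetric_bilinear_simps [OF B])
  moreover have "y \<in> W" unfolding y_def v'_def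
    using W v x by (intro vec.subspace_scale vec.subspace_diff) auto
  ultimately show ?thesis using that by blast
qed

text \<open>Let \<open>x\<close>, \<open>y\<close> be a hyperbolic pair. Every vector of \<open>W\<close> differs by a combination of \<open>x\<close> and \<open>y\<close> from a vector
\<open>v'\<close> orthogonal to both, and \<open>x + v' - B v' v' y\<close> is isotropic; so isotropic vectors span \<open>W\<close>.\<close>

lemma conic_spans:
  assumes C: "is_conic C W B"
  shows "vec.span (\<Union>C) = W"
proof
  have B: "symmetric_bilinear B" and W: "vec.subspace W" "vec.dim W = 3"
    using C by (auto simp: is_conic_def)
  show "vec.span (\<Union>C) \<subseteq> W"
    using C W(1) by (intro vec.span_minimal) (auto simp: is_conic_def projectivization_def)
  have iso: "v \<in> vec.span (\<Union>C)" if "v \<in> W" "B v v = 0" for v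
  proof (cases "v = 0")
    case False
    then have "v \<in> \<Union>C" using conic_memI [OF C] that vec.span_base [of v "{v}"] by blast
    then show ?thesis by (rule vec.span_base)
  qed (simp add: vec.span_zero)
  show "W \<subseteq> vec.span (\<Union>C)"
  proof
    fix v assume "v \<in> W"
    obtain x where x: "x \<in> W" "x \<noteq> 0" "B x x = 0"
      using isotropic_vector_exists [OF B W(1)] W(2) by auto
    then obtain y where y: "y \<in> W" "B y y = 0" "2 * B x y = 1" using hyperbolic_partner [OF C] by metis
    define v' where "v' = v - (2 * B v y) *s x - (2 * B v x) *s y"
    define w where "w = x + v' - B v' v' *s y"
    have "B v' x = 0" "B v' y = 0"
      using x y symmetric_bilinear_commute [OF B, of y x]
      by (simp_all add: v'_def symmetric_bilinear_simps [OF B])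
    moreover have "B v' x = B x v'" "B v' y = B y v'" using symmetric_bilinear_commute [OF B] by blast+
    ultimately have "B w w = 0"
      using x y symmetric_bilinear_commute [OF B, of y x]
      by (simp add: w_def symmetric_bilinear_simps [OF B])
    moreover have "w \<in> W" unfolding w_def v'_def using W(1) \<open>v \<in> W\<close> x y
      by (intro vec.subspace_add vec.subspace_diff vec.subspace_scale) auto
    ultimately have "w \<in> vec.span (\<Union>C)" by (rule iso [rotated])
    moreover have "v = w - x + B v' v' *s y + (2 * B v y) *s x + (2 * B v x) *s y"
      by (simp add: w_def v'_def)
    ultimately show "v \<in> vec.span (\<Union>C)"
      using iso [OF x(1,3)] iso [OF y(1,2)]
      by (metis vec.span_add vec.span_diff vec.span_scale)
  qed
qed

lemma projective_span_conic: "is_conic C W B \<Longrightarrow> projective_span C = projectivization W"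
  by (simp add: projective_span_def conic_spans)

lemma conic_ideal_iff:
  assumes C: "is_conic C W B"
  shows "f \<in> vanishing_ideal C \<longleftrightarrow> (\<forall>x\<in>W. B x x = 0 \<longrightarrow> eval4 f x = 0)"
proof
  assume f: "f \<in> vanishing_ideal C"
  have *: "eval4 f y = 0" if "x \<in> W" "x \<noteq> 0" "B x x = 0" "y \<in> vec.span {x}" for x y
    using f conic_memI [OF C that(1-3)] that(4) by (auto simp: vanishing_ideal_def vanishes_at_def)
  obtain x where x: "x \<in> W" "x \<noteq> 0" "B x x = 0"
    using isotropic_vector_exists [of B W] C by (auto simp: is_conic_def)
  then have "eval4 f 0 = 0" using * [OF x vec.span_zero] by simp
  then show "\<forall>x\<in>W. B x x = 0 \<longrightarrow> eval4 f x = 0" using * vec.span_base by (metis insertI1)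
next
  assume "\<forall>x\<in>W. B x x = 0 \<longrightarrow> eval4 f x = 0"
  then show "f \<in> vanishing_ideal C" using C
    by (auto simp: vanishing_ideal_def vanishes_at_def is_conic_def projectivization_def)
qed

lemma subspace_separating_form:
  fixes W :: "(complex^4) set"
  assumes "vec.subspace W" "v \<notin> W"
  obtains M :: "complex^4^4" where "\<And>x. x \<in> W \<Longrightarrow> (M *v x) $ 1 = 0" "(M *v v) $ 1 = 1"
proof -
  obtain S where S: "S \<subseteq> W" "vec.independent S" "W \<subseteq> vec.span S"
    using vec.maximal_independent_subset by blast
  then have span: "vec.span S = W" using assms(1) by (metis vec.span_subspace)
  then have "vec.independent (insert v S)" using S assms(2) by (simp add: vec.independent_insertI)
  then obtain g where g: "Vector_Spaces.linear (*s) (*s) g" "\<forall>x\<in>insert v S. g x = (if x = v then axis 1 1 else 0 :: complex^4)"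
    using vec.linear_independent_extend [where f = "\<lambda>x. if x = v then axis 1 1 else 0"] by blast
  have gM: "matrix g *v x = g x" for x using g(1) by (rule matrix_works)
  have "v \<notin> S" using S assms(2) by blast
  then have "g x = 0" if "x \<in> S" for x using g(2) that by auto
  then have "g x = 0" if "x \<in> W" for x
    using vec.linear_eq_0_on_span [OF g(1)] that span by blast
  then show ?thesis using that [of "matrix g"] g(2) by (simp add: gM)
qed

text \<open>The tangent line is the polar line. A tangent vector lies in the polar line because the equation of the
conic and the linear forms vanishing on \<open>W\<close> belong to the ideal. Conversely, for \<open>v\<close> in the polar line
of \<open>x\<close>, a hyperbolic partner \<open>y\<close> of \<open>x\<close> gives the polynomial curve
\<open>(1 + 2 t B v y) (x + t v) - t\<^sup>2 B v v y\<close> of isotropic vectors, whose velocity at \<open>x\<close> is \<open>v\<close> up to a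
multiple of \<open>x\<close>; every polynomial vanishing on the conic vanishes along this curve.\<close>

lemma conic_tangent_line:
  assumes C: "is_conic C W B" and x: "x \<in> W" "x \<noteq> 0" "B x x = 0"
  shows "tangent_line C (vec.span {x}) = projectivization {v \<in> W. B x v = 0}"
proof -
  have B: "symmetric_bilinear B" and W: "vec.subspace W" and pf: "polyfun (\<lambda>x. B x x)"
    using C by (auto simp: is_conic_def)
  have 1: "v \<in> W \<and> B x v = 0"
    if v: "\<And>f x'. f \<in> vanishing_ideal C \<Longrightarrow> x' \<in> vec.span {x} - {0} \<Longrightarrow> differential4 f x' v = 0" for v
  proof
    have xx: "x \<in> vec.span {x} - {0}" using x by (simp add: vec.span_base)
    show "v \<in> W"
    proof (rule ccontr)
      assume "v \<notin> W"
      then obtain M :: "complex^4^4" where M: "\<And>x. x \<in> W \<Longrightarrow> (M *v x) $ 1 = 0" "(M *v v) $ 1 = 1"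
        using subspace_separating_form [OF W] by metis
      have "polyfun (\<lambda>x. (M *v x) $ 1)" using polyfun_linear_subst [OF polyfun_coord] .
      then obtain f where f: "(\<lambda>x. (M *v x) $ 1) = eval4 f" by (rule polyfunE)
      then have f: "eval4 f x = (M *v x) $ 1" for x by metis
      then have "f \<in> vanishing_ideal C" using M(1) by (simp add: conic_ideal_iff [OF C])
      moreover have "differential4 f x v = 1"
      proof -
        have "eval4 f (x + t *s v) = t" for t
          using M x by (simp add: f matrix_vector_right_distrib vector_scalar_commute)
        then show ?thesis by (simp add: differential4_def)
      qed
      ultimately show False using v [OF _ xx] by simp
    qed
    obtain f where "(\<lambda>x. B x x) = eval4 f" using pf by (rule polyfunE)
    then have f: "eval4 f x = B x x" for x by metis
    then have "f \<in> vanishing_ideal C" by (simp add: conic_ideal_iff [OF C])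
    then have "differential4 f x v = 0" using v xx by blast
    moreover have "((\<lambda>t. eval4 f (x + t *s v)) has_field_derivative 2 * B x v) (at 0)"
    proof -
      have "((\<lambda>t. B x x + 2 * B x v * t + B v v * t^2) has_field_derivative 2 * B x v) (at 0)"
        by (auto intro!: derivative_eq_intros)
      then show ?thesis unfolding f
        by (simp add: symmetric_bilinear_simps [OF B] symmetric_bilinear_commute [OF B, of v x] algebra_simps power2_eq_square)
    qed
    ultimately show "B x v = 0" unfolding differential4_def using DERIV_imp_deriv by fastforce
  qed
  have 2: "differential4 f x v = 0"
    if f: "f \<in> vanishing_ideal C" and x: "x \<in> W" "x \<noteq> 0" "B x x = 0" and v: "v \<in> W" "B x v = 0" for f x v
  proof -
    obtain y where y: "y \<in> W" "B y y = 0" "2 * B x y = 1" using hyperbolic_partner [OF C x] by metis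
    obtain d where d: "\<And>\<gamma> \<gamma>'. \<gamma> 0 = x \<Longrightarrow> (\<And>i. ((\<lambda>t. \<gamma> t $ i) has_field_derivative \<gamma>' $ i) (at 0))
        \<Longrightarrow> ((\<lambda>t. eval4 f (\<gamma> t)) has_field_derivative (\<Sum>i\<in>UNIV. d i * \<gamma>' $ i)) (at 0)"
      using polyfun_gradient [OF polyfun_eval4 [of f], of x] by blast
    have zero: "eval4 f z = 0" if "z \<in> W" "B z z = 0" for z
      using f that by (simp add: conic_ideal_iff [OF C])
    have dzero: "(\<Sum>i\<in>UNIV. d i * \<gamma>' $ i) = 0"
      if "\<gamma> 0 = x" "\<And>i. ((\<lambda>t. \<gamma> t $ i) has_field_derivative \<gamma>' $ i) (at 0)"
        "\<And>t. \<gamma> t \<in> W" "\<And>t. B (\<gamma> t) (\<gamma> t) = 0" for \<gamma> \<gamma>'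
    proof -
      have "((\<lambda>t. 0) has_field_derivative (\<Sum>i\<in>UNIV. d i * \<gamma>' $ i)) (at 0)"
        using d [OF that(1,2)] zero [OF that(3,4)] by simp
      then show ?thesis using DERIV_unique DERIV_const by blast
    qed
    have dx: "(\<Sum>i\<in>UNIV. d i * x $ i) = 0"
    proof (rule dzero [of "\<lambda>t. (1 + t) *s x"])
      show "((\<lambda>t. ((1 + t) *s x) $ i) has_field_derivative x $ i) (at 0)" for i
        by (auto intro!: derivative_eq_intros)
      show "(1 + t) *s x \<in> W" for t using W x by (intro vec.subspace_scale)
    qed (simp_all add: symmetric_bilinear_simps [OF B] x)
    define k where "k = 2 * B v y"
    define \<gamma> where "\<gamma> t = (1 + t * k) *s (x + t *s v) - (t^2 * B v v) *s y" for t
    have "(\<Sum>i\<in>UNIV. d i * (v + k *s x) $ i) = 0"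
    proof (rule dzero [of \<gamma>])
      show "((\<lambda>t. \<gamma> t $ i) has_field_derivative (v + k *s x) $ i) (at 0)" for i
        unfolding \<gamma>_def by (auto intro!: derivative_eq_intros)
      show "\<gamma> t \<in> W" for t unfolding \<gamma>_def
        using W x v y by (intro vec.subspace_diff vec.subspace_add vec.subspace_scale)
      show "B (\<gamma> t) (\<gamma> t) = 0" for t
      proof -
        have "B y x = B x y" "B y v = B v y" "B v x = B x v"
          using symmetric_bilinear_commute [OF B] by blast+
        then have "B (\<gamma> t) (\<gamma> t) = (1 + t * k) * t^2 * B v v * (1 + t * k - 2 * B x y - t * k)"
          using x(3) y(2) v(2)
          by (simp add: \<gamma>_def k_def symmetric_bilinear_simps [OF B] power2_eq_square algebra_simps)
        then show ?thesis using y(3) by simp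
      qed
    qed (simp add: \<gamma>_def)
    then have "(\<Sum>i\<in>UNIV. d i * v $ i) + k * (\<Sum>i\<in>UNIV. d i * x $ i) = 0"
      by (simp add: distrib_left sum.distrib sum_distrib_left mult_ac)
    then have dv: "(\<Sum>i\<in>UNIV. d i * v $ i) = 0" using dx by simp
    have "((\<lambda>t. eval4 f (x + t *s v)) has_field_derivative (\<Sum>i\<in>UNIV. d i * v $ i)) (at 0)"
      by (rule d) (auto intro!: derivative_eq_intros)
    then show ?thesis unfolding differential4_def dv by (rule DERIV_imp_deriv)
  qed
  have "{v. \<forall>f\<in>vanishing_ideal C. \<forall>x\<in>vec.span {x} - {0}. differential4 f x v = 0} = {v \<in> W. B x v = 0}"
  proof (intro subset_antisym subsetI)
    fix v assume "v \<in> {v. \<forall>f\<in>vanishing_ideal C. \<forall>x\<in>vec.span {x} - {0}. differential4 f x v = 0}"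
    then show "v \<in> {v \<in> W. B x v = 0}" using 1 by blast
  next
    fix v assume "v \<in> {v \<in> W. B x v = 0}"
    then have v: "v \<in> W" "B x v = 0" by auto
    have "differential4 f x' v = 0"
      if f: "f \<in> vanishing_ideal C" and "x' \<in> vec.span {x}" "x' \<noteq> 0" for f x'
    proof -
      from \<open>x' \<in> vec.span {x}\<close> obtain c where c: "x' = c *s x" using span_singleton_iff by blast
      have "x' \<in> W" "B x' x' = 0" "B x' v = 0"
        using x v W by (auto simp: c symmetric_bilinear_simps [OF B] intro: vec.subspace_scale)
      then show ?thesis using 2 [OF f _ \<open>x' \<noteq> 0\<close>] v by blast
    qed
    then show "v \<in> {v. \<forall>f\<in>vanishing_ideal C. \<forall>x\<in>vec.span {x} - {0}. differential4 f x v = 0}" by blast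
  qed
  then show ?thesis unfolding tangent_line_def by simp
qed

section \<open>Normal form of a pair of conics\<close>

lemma plane_eq_line_plus_vector:
  fixes L W :: "(complex^4) set"
  assumes "vec.subspace L" "vec.subspace W" "L \<subseteq> W" "vec.dim L = 2" "vec.dim W = 3"
    and "e \<in> W" "e \<notin> L" "w \<in> W"
  obtains l c where "l \<in> L" "w = l + c *s e"
proof -
  have L: "vec.span L = L" using assms(1) by (simp add: vec.span_eq_iff)
  have "vec.span (insert e L) = W"
  proof (rule vec.subspace_dim_equal)
    show "vec.span (insert e L) \<subseteq> W" using assms by (intro vec.span_minimal) auto
    show "vec.dim W \<le> vec.dim (vec.span (insert e L))"
      using assms by (simp add: vec.dim_insert L)
  qed (use assms in auto)
  then obtain c where "w - c *s e \<in> L"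
    using assms(8) vec.span_breakdown_eq [of w e L] L by auto
  then show ?thesis using that [of "w - c *s e" c] by simp
qed

lemma line_eq_span_pair:
  fixes L :: "(complex^4) set"
  assumes L: "vec.subspace L" "vec.dim L = 2" and e: "e1 \<in> L" "e2 \<in> L" "e1 \<notin> vec.span {e2}" "e2 \<noteq> 0"
    and l: "l \<in> L"
  obtains x y where "l = x *s e1 + y *s e2"
proof -
  have "vec.span {e1, e2} = L"
  proof (rule vec.subspace_dim_equal)
    show "vec.span {e1, e2} \<subseteq> L" using assms by (intro vec.span_minimal) auto
    show "vec.dim L \<le> vec.dim (vec.span {e1, e2})" using assms by (simp add: vec.dim_insert)
  qed (use assms in auto)
  then obtain x where "l - x *s e1 \<in> vec.span {e2}"
    using l vec.span_breakdown_eq [of l e1 "{e2}"] by auto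
  then obtain y where "l - x *s e1 = y *s e2" using span_singleton_iff by blast
  then have "l = x *s e1 + y *s e2" by (simp add: algebra_simps)
  then show ?thesis using that by blast
qed

text \<open>If the isotropic vector \<open>u\<close> were orthogonal to the line \<open>L\<close>, then \<open>L\<close> would be the tangent line at \<open>u\<close>, and the
conic would be tangent to every plane through \<open>L\<close>.\<close>

lemma nondegenerate_on_line:
  assumes C: "is_conic C W B" and "\<not> tangent_to_plane C (projectivization W')"
    and L: "vec.subspace L" "vec.dim L = 2" "L \<subseteq> W" "L \<subseteq> W'"
    and u: "u \<in> L" "u \<noteq> 0" "B u u = 0"
  shows "\<exists>v\<in>L. B u v \<noteq> 0"
proof (rule ccontr)
  assume "\<not> (\<exists>v\<in>L. B u v \<noteq> 0)"
  then have zero: "B u l = 0" if "l \<in> L" for l using that by blast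
  have W: "vec.subspace W" "vec.dim W = 3" and B: "symmetric_bilinear B"
    using C by (auto simp: is_conic_def)
  have "u \<in> W" using u L by blast
  then obtain e where e: "e \<in> W" "B u e \<noteq> 0" using C u unfolding is_conic_def by blast
  then have "e \<notin> L" using zero by blast
  have "v \<in> W'" if vW: "v \<in> W" and "B u v = 0" for v
  proof -
    obtain l c where "l \<in> L" "v = l + c *s e"
      using plane_eq_line_plus_vector [OF L(1) W(1) L(3,2) W(2) e(1) \<open>e \<notin> L\<close> vW] by metis
    moreover from this have "c = 0"
      using that(2) e(2) zero by (simp add: symmetric_bilinear_simps [OF B])
    ultimately show ?thesis using L(4) by auto
  qed
  then have "tangent_line C (vec.span {u}) \<subseteq> projectivization W'"
    unfolding conic_tangent_line [OF C \<open>u \<in> W\<close> u(2,3)] by (auto simp: projectivization_def)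
  moreover have "vec.span {u} \<in> C" using conic_memI [OF C \<open>u \<in> W\<close> u(2,3)] .
  ultimately show False using assms(2) by (auto simp: tangent_to_plane_def)
qed

text \<open>Take an isotropic basis \<open>u\<close>, \<open>v\<close> of \<open>L\<close> for \<open>A\<close>. Neither vector is isotropic for \<open>B\<close>, so \<open>v\<close> can be
rescaled to get \<open>B u u = B v v\<close>. Then \<open>u + v\<close> and \<open>u - v\<close> are orthogonal for both forms. The difference of
the eigenvalues is \<open>2 B u u / A u v\<close>, which is nonzero.\<close>

lemma simultaneous_diagonalization:
  assumes A: "symmetric_bilinear A" and B: "symmetric_bilinear B"
    and L: "vec.subspace L" "vec.dim L = 2"
    and ndA: "\<And>u. u \<in> L \<Longrightarrow> u \<noteq> 0 \<Longrightarrow> A u u = 0 \<Longrightarrow> \<exists>v\<in>L. A u v \<noteq> 0"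
    and ndB: "\<And>u. u \<in> L \<Longrightarrow> u \<noteq> 0 \<Longrightarrow> B u u = 0 \<Longrightarrow> \<exists>v\<in>L. B u v \<noteq> 0"
    and disj: "\<And>u. u \<in> L \<Longrightarrow> u \<noteq> 0 \<Longrightarrow> A u u = 0 \<Longrightarrow> B u u \<noteq> 0"
  obtains e1 e2 where "e1 \<in> L" "e2 \<in> L" "A e1 e1 = 1" "A e2 e2 = 1" "A e1 e2 = 0"
    "B e1 e2 = 0" "B e1 e1 \<noteq> 0" "B e2 e2 \<noteq> 0" "B e1 e1 \<noteq> B e2 e2"
    "\<And>l. l \<in> L \<Longrightarrow> \<exists>x y. l = x *s e1 + y *s e2"
proof -
  note simps = symmetric_bilinear_simps [OF A] symmetric_bilinear_simps [OF B]
  obtain u where u: "u \<in> L" "u \<noteq> 0" "A u u = 0"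
    using isotropic_vector_exists [OF A L(1)] L(2) by auto
  obtain v0 where v0: "v0 \<in> L" "A u v0 \<noteq> 0" using ndA [OF u] by blast
  define v1 where "v1 = v0 - (A v0 v0 / (2 * A u v0)) *s u"
  have v1: "v1 \<in> L" "A u v1 = A u v0" "A v1 v1 = 0"
    using u v0 L symmetric_bilinear_commute [OF A, of v0 u]
    by (auto simp: v1_def simps intro!: vec.subspace_diff vec.subspace_scale)
  have "v1 \<noteq> 0" using v1 v0 simps(8) by metis
  have Bu: "B u u \<noteq> 0" and Bv1: "B v1 v1 \<noteq> 0" using disj u v1 \<open>v1 \<noteq> 0\<close> by blast+
  define k where "k = csqrt (B u u / B v1 v1)"
  \<comment> \<open>This scaling makes \<open>B v v\<close> equal to \<open>B u u\<close>.\<close>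
  define v where "v = k *s v1"
  have "k \<noteq> 0" using Bu Bv1 by (simp add: k_def)
  have "k * (k * B v1 v1) = k^2 * B v1 v1" by (simp add: power2_eq_square)
  also have "\<dots> = B u u" using Bv1 by (simp add: k_def)
  finally have Bv: "B v v = B u u" by (simp add: v_def simps)
  have v: "v \<in> L" "A u v \<noteq> 0" "A v v = 0"
    using v1 L v0 \<open>k \<noteq> 0\<close> by (auto simp: v_def simps intro!: vec.subspace_scale)
  have sym: "A v u = A u v" "B v u = B u v" using symmetric_bilinear_commute A B by blast+
  define r s where "r = csqrt (2 * A u v)" and "s = csqrt (- (2 * A u v))"
  have rs: "r * r = 2 * A u v" "s * s = - (2 * A u v)" "r \<noteq> 0" "s \<noteq> 0"
    using v(2) by (auto simp: r_def s_def simp flip: power2_eq_square)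
  define e1 where "e1 = (1 / r) *s (u + v)"
  define e2 where "e2 = (1 / s) *s (u - v)"
  have e: "e1 \<in> L" "e2 \<in> L" unfolding e1_def e2_def
    using L u v by (auto intro!: vec.subspace_scale vec.subspace_add vec.subspace_diff)
  have "A e1 e1 = 2 * A u v / (r * r)" "A e2 e2 = - (2 * A u v) / (s * s)"
    by (simp_all add: e1_def e2_def simps u v sym)
  then have A12: "A e1 e1 = 1" "A e2 e2 = 1" unfolding rs(1,2) using v(2) by simp_all
  have orth: "A e1 e2 = 0" "B e1 e2 = 0" by (simp_all add: e1_def e2_def simps u v sym Bv)
  have "B e1 e1 = 2 * (B u u + B u v) / (r * r)" "B e2 e2 = 2 * (B u u - B u v) / (s * s)"
    by (simp_all add: e1_def e2_def simps sym Bv add_divide_distrib diff_divide_distrib distrib_left right_diff_distrib)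
  then have B12: "B e1 e1 = (B u u + B u v) / A u v" "B e2 e2 = - ((B u u - B u v) / A u v)"
    unfolding rs(1,2)
    by (simp_all only: divide_minus_right mult_divide_mult_cancel_left_if) simp_all
  have "B e1 e1 - B e2 e2 = 2 * B u u / A u v" unfolding B12 by (simp add: add_divide_distrib [symmetric])
  then have neq: "B e1 e1 \<noteq> B e2 e2" using Bu v(2) by auto
  have "e1 \<noteq> 0" "e2 \<noteq> 0" using A12 simps(8) by force+
  have "e1 \<notin> vec.span {e2}"
  proof
    assume "e1 \<in> vec.span {e2}"
    then obtain c where "e1 = c *s e2" using span_singleton_iff by blast
    then have "A e1 e1 = c * A e1 e2" by (metis simps(4))
    then show False using A12 orth by simp
  qed
  then have span: "\<exists>x y. l = x *s e1 + y *s e2" if "l \<in> L" for l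
    using line_eq_span_pair [OF L e _ \<open>e2 \<noteq> 0\<close> that] by metis
  have sym': "A e2 e1 = 0" "B e2 e1 = 0" using symmetric_bilinear_commute A B orth by metis+
  have "B e1 e1 \<noteq> 0"
  proof
    assume 0: "B e1 e1 = 0"
    then obtain l where "l \<in> L" "B e1 l \<noteq> 0" using ndB [OF e(1) \<open>e1 \<noteq> 0\<close>] by blast
    then show False using span [of l] 0 orth by (auto simp: simps)
  qed
  moreover have "B e2 e2 \<noteq> 0"
  proof
    assume 0: "B e2 e2 = 0"
    then obtain l where "l \<in> L" "B e2 l \<noteq> 0" using ndB [OF e(2) \<open>e2 \<noteq> 0\<close>] by blast
    then show False using span [of l] 0 sym' by (auto simp: simps)
  qed
  ultimately show ?thesis using that [OF e A12 orth _ _ neq span] by blast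
qed

text \<open>The added vector represents the pole of the line \<open>L\<close> with respect to the conic. It is not isotropic,
since it would otherwise be orthogonal to all of \<open>W\<close>.\<close>

lemma complete_orthogonal_basis:
  assumes C: "is_conic C W B" and L: "vec.subspace L" "vec.dim L = 2" "L \<subseteq> W"
    and e: "e1 \<in> L" "e2 \<in> L" "B e1 e2 = 0" "B e1 e1 \<noteq> 0" "B e2 e2 \<noteq> 0"
    and span: "\<And>l. l \<in> L \<Longrightarrow> \<exists>x y. l = x *s e1 + y *s e2"
  obtains e3 where "e3 \<in> W" "e3 \<notin> L" "B e3 e1 = 0" "B e3 e2 = 0" "B e3 e3 = 1"
proof -
  have W: "vec.subspace W" "vec.dim W = 3" and B: "symmetric_bilinear B"
    using C by (auto simp: is_conic_def)
  note simps = symmetric_bilinear_simps [OF B]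
  have sym: "B e2 e1 = 0" using symmetric_bilinear_commute [OF B] e(3) by metis
  have "\<not> W \<subseteq> L" using vec.dim_subset [of W L] W(2) L(2) by auto
  then obtain e where "e \<in> W" "e \<notin> L" by blast
  define f where "f = e - ((B e e1 / B e1 e1) *s e1 + (B e e2 / B e2 e2) *s e2)"
  have "f \<in> W" unfolding f_def using \<open>e \<in> W\<close> e L W
    by (intro vec.subspace_diff vec.subspace_add vec.subspace_scale) auto
  have "f \<notin> L"
  proof
    assume "f \<in> L"
    then have "f + ((B e e1 / B e1 e1) *s e1 + (B e e2 / B e2 e2) *s e2) \<in> L"
      using e L by (intro vec.subspace_add vec.subspace_scale) auto
    then show False using \<open>e \<notin> L\<close> by (simp add: f_def)
  qed
  have f: "B f e1 = 0" "B f e2 = 0" using e by (simp_all add: f_def simps sym)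
  have "B f f \<noteq> 0"
  proof
    assume 0: "B f f = 0"
    have "f \<noteq> 0" using \<open>f \<notin> L\<close> L(1) vec.subspace_0 by metis
    then obtain v where v: "v \<in> W" "B f v \<noteq> 0" using C \<open>f \<in> W\<close> 0 unfolding is_conic_def by blast
    obtain l c where l: "l \<in> L" and vl: "v = l + c *s f"
      using plane_eq_line_plus_vector [OF L(1) W(1) L(3,2) W(2) \<open>f \<in> W\<close> \<open>f \<notin> L\<close> v(1)] by metis
    obtain x y where "l = x *s e1 + y *s e2" using span [OF l] by blast
    then show False using v(2) by (simp add: vl simps f 0)
  qed
  define e3 where "e3 = (1 / csqrt (B f f)) *s f"
  have "csqrt (B f f) * csqrt (B f f) = B f f" by (simp flip: power2_eq_square)
  then have "B e3 e3 = 1" "B e3 e1 = 0" "B e3 e2 = 0"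
    using \<open>B f f \<noteq> 0\<close> by (simp_all add: e3_def simps f)
  moreover have "e3 \<in> W" unfolding e3_def using \<open>f \<in> W\<close> W by (intro vec.subspace_scale)
  moreover have "e3 \<notin> L"
  proof
    assume "e3 \<in> L"
    then have "csqrt (B f f) *s e3 \<in> L" using L(1) by (intro vec.subspace_scale)
    then show False using \<open>f \<notin> L\<close> \<open>B f f \<noteq> 0\<close> by (simp add: e3_def)
  qed
  ultimately show ?thesis using that by blast
qed

lemma planes_meet_in_line:
  fixes V W :: "(complex^4) set"
  assumes "vec.subspace V" "vec.subspace W" "vec.dim V = 3" "vec.dim W = 3" "V \<noteq> W"
  shows "vec.dim (V \<inter> W) = 2"
proof -
  have "vec.dim {x + y |x y. x \<in> V \<and> y \<in> W} \<le> 4"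
    using vec.dim_subset_UNIV [of "{x + y |x y. x \<in> V \<and> y \<in> W}"] by (simp add: vec.dimension_def card_cart_basis)
  then have "vec.dim (V \<inter> W) \<ge> 2" using vec.dim_sums_Int [OF assms(1,2)] assms by linarith
  \<comment> \<open>Otherwise both planes would coincide with their intersection.\<close>
  moreover have "vec.dim (V \<inter> W) \<noteq> 3"
  proof
    assume 3: "vec.dim (V \<inter> W) = 3"
    have VW: "vec.subspace (V \<inter> W)" using assms by (intro vec.subspace_inter)
    have "V \<inter> W = V" by (rule vec.subspace_dim_equal [OF VW]) (use assms 3 in auto)
    moreover have "V \<inter> W = W" by (rule vec.subspace_dim_equal [OF VW]) (use assms 3 in auto)
    ultimately show False using assms by blast
  qed
  moreover have "vec.dim (V \<inter> W) \<le> 3" using vec.dim_subset [of "V \<inter> W" V] assms by simp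
  ultimately show ?thesis by linarith
qed

text \<open>The columns of \<open>M\<close> are a basis of the common line of the planes that diagonalizes both forms, followed
by the poles of this line with respect to the two conics; \<open>1 / a\<close> and \<open>1 / b\<close> are the eigenvalues of the
second form relative to the first.\<close>

lemma conic_pair_normal_form:
  assumes C1: "is_conic C1 W1 B1" and C2: "is_conic C2 W2 B2" and "W1 \<noteq> W2" "C1 \<inter> C2 = {}"
    and t1: "\<not> tangent_to_plane C1 (projectivization W2)" and t2: "\<not> tangent_to_plane C2 (projectivization W1)"
  obtains M M' :: "complex^4^4" and a b where "M ** M' = mat 1" "M' ** M = mat 1"
    "a \<noteq> 0" "b \<noteq> 0" "a \<noteq> b"
    "\<And>x. M *v x \<in> W1 \<longleftrightarrow> x $ 4 = 0" "\<And>x. M *v x \<in> W2 \<longleftrightarrow> x $ 3 = 0"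
    "\<And>x y. x $ 4 = 0 \<Longrightarrow> y $ 4 = 0 \<Longrightarrow> B1 (M *v x) (M *v y) = x $ 1 * y $ 1 + x $ 2 * y $ 2 + x $ 3 * y $ 3"
    "\<And>x y. x $ 3 = 0 \<Longrightarrow> y $ 3 = 0 \<Longrightarrow> B2 (M *v x) (M *v y) = x $ 1 * y $ 1 / a + x $ 2 * y $ 2 / b + x $ 4 * y $ 4"
proof -
  define L where "L = W1 \<inter> W2"
  have W: "vec.subspace W1" "vec.dim W1 = 3" "vec.subspace W2" "vec.dim W2 = 3"
    and B1: "symmetric_bilinear B1" and B2: "symmetric_bilinear B2"
    using C1 C2 by (auto simp: is_conic_def)
  note simps = symmetric_bilinear_simps [OF B1] symmetric_bilinear_simps [OF B2]
  have L: "vec.subspace L" "vec.dim L = 2" "L \<subseteq> W1" "L \<subseteq> W2"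
    using W \<open>W1 \<noteq> W2\<close> planes_meet_in_line by (auto simp: L_def intro: vec.subspace_inter)
  obtain e1 e2 where e: "e1 \<in> L" "e2 \<in> L" and e1: "B1 e1 e1 = 1" "B1 e2 e2 = 1" "B1 e1 e2 = 0"
    and e2: "B2 e1 e2 = 0" "B2 e1 e1 \<noteq> 0" "B2 e2 e2 \<noteq> 0" and neq: "B2 e1 e1 \<noteq> B2 e2 e2"
    and span: "\<And>l. l \<in> L \<Longrightarrow> \<exists>x y. l = x *s e1 + y *s e2"
  proof (rule simultaneous_diagonalization [OF B1 B2 L(1,2)])
    show "\<exists>v\<in>L. B1 u v \<noteq> 0" if "u \<in> L" "u \<noteq> 0" "B1 u u = 0" for u
      using nondegenerate_on_line [OF C1 t1 L that] .
    show "\<exists>v\<in>L. B2 u v \<noteq> 0" if "u \<in> L" "u \<noteq> 0" "B2 u u = 0" for u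
      using nondegenerate_on_line [OF C2 t2 L(1,2,4,3) that] .
    show "B2 u u \<noteq> 0" if "u \<in> L" "u \<noteq> 0" "B1 u u = 0" for u
      using conic_memI [OF C1, of u] conic_memI [OF C2, of u] that L \<open>C1 \<inter> C2 = {}\<close> by blast
  qed (rule that)
  obtain e3 where e3: "e3 \<in> W1" "e3 \<notin> L" "B1 e3 e1 = 0" "B1 e3 e2 = 0" "B1 e3 e3 = 1"
    using complete_orthogonal_basis [OF C1 L(1-3) e e1(3) _ _ span] e1 by auto
  obtain e4 where e4: "e4 \<in> W2" "e4 \<notin> L" "B2 e4 e1 = 0" "B2 e4 e2 = 0" "B2 e4 e4 = 1"
    using complete_orthogonal_basis [OF C2 L(1,2,4) e e2(1) _ _ span] e2 by auto
  have sym: "B1 e2 e1 = 0" "B1 e1 e3 = 0" "B1 e2 e3 = 0" "B2 e2 e1 = 0" "B2 e1 e4 = 0" "B2 e2 e4 = 0"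
    using symmetric_bilinear_commute [OF B1] symmetric_bilinear_commute [OF B2] e1 e2 e3 e4 by metis+
  define E where "E = (\<lambda>j :: 4. if j = 1 then e1 else if j = 2 then e2 else if j = 3 then e3 else e4)"
  define M :: "complex^4^4" where "M = (\<chi> i j. E j $ i)"
  have M: "M *v x = x $ 1 *s e1 + x $ 2 *s e2 + x $ 3 *s e3 + x $ 4 *s e4" for x
    by (simp add: vec_eq_iff M_def E_def matrix_vector_mult_def sum_4 mult.commute)
  have eW: "e1 \<in> W1" "e2 \<in> W1" "e1 \<in> W2" "e2 \<in> W2" using e L by auto
  have scaleL: "c = 0" if "c *s f \<in> L" "f \<notin> L" for c f
  proof (rule ccontr)
    assume "c \<noteq> 0"
    have "(1 / c) *s (c *s f) \<in> L" using L(1) that(1) by (rule vec.subspace_scale)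
    then show False using \<open>c \<noteq> 0\<close> that(2) by simp
  qed
  have in1: "M *v x \<in> W1 \<longleftrightarrow> x $ 4 = 0" for x
  proof
    assume "M *v x \<in> W1"
    moreover have l: "x $ 1 *s e1 + x $ 2 *s e2 + x $ 3 *s e3 \<in> W1"
      by (intro vec.subspace_add vec.subspace_scale W(1) eW e3(1))
    ultimately have "M *v x - (x $ 1 *s e1 + x $ 2 *s e2 + x $ 3 *s e3) \<in> W1"
      using W by (intro vec.subspace_diff)
    then have "x $ 4 *s e4 \<in> W1" by (simp add: M)
    moreover have "x $ 4 *s e4 \<in> W2" using W e4 by (intro vec.subspace_scale)
    ultimately show "x $ 4 = 0" using scaleL e4(2) by (simp add: L_def)
  next
    assume "x $ 4 = 0"
    then show "M *v x \<in> W1" unfolding M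
      by (auto intro!: vec.subspace_add vec.subspace_scale W(1) eW e3(1))
  qed
  have in2: "M *v x \<in> W2 \<longleftrightarrow> x $ 3 = 0" for x
  proof
    assume "M *v x \<in> W2"
    moreover have l: "x $ 1 *s e1 + x $ 2 *s e2 + x $ 4 *s e4 \<in> W2"
      by (intro vec.subspace_add vec.subspace_scale W(3) eW e4(1))
    ultimately have "M *v x - (x $ 1 *s e1 + x $ 2 *s e2 + x $ 4 *s e4) \<in> W2"
      using W by (intro vec.subspace_diff)
    then have "x $ 3 *s e3 \<in> W2" by (simp add: M)
    moreover have "x $ 3 *s e3 \<in> W1" using W e3 by (intro vec.subspace_scale)
    ultimately show "x $ 3 = 0" using scaleL e3(2) by (simp add: L_def)
  next
    assume "x $ 3 = 0"
    then show "M *v x \<in> W2" unfolding M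
      by (auto intro!: vec.subspace_add vec.subspace_scale W(3) eW e4(1))
  qed
  have "c = 0" if "M *v c = 0" for c
  proof -
    have "c $ 4 = 0" "c $ 3 = 0" using in1 [of c] in2 [of c] that W vec.subspace_0 by auto
    then have "B1 (M *v c) e1 = c $ 1" "B1 (M *v c) e2 = c $ 2"
      by (simp_all add: M simps e1 sym)
    then show ?thesis using that simps(7) \<open>c $ 4 = 0\<close> \<open>c $ 3 = 0\<close>
      by (simp add: vec_eq_iff forall_4)
  qed
  then obtain M' where M': "M' ** M = mat 1"
    using matrix_left_invertible_ker [of M] by blast
  then have "M ** M' = mat 1" using matrix_left_right_inverse by blast
  moreover have "1 / B2 e1 e1 \<noteq> 0" "1 / B2 e2 e2 \<noteq> 0" "1 / B2 e1 e1 \<noteq> 1 / B2 e2 e2"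
    using e2 neq by (auto simp: field_simps)
  moreover have "B1 (M *v x) (M *v y) = x $ 1 * y $ 1 + x $ 2 * y $ 2 + x $ 3 * y $ 3" if "x $ 4 = 0" "y $ 4 = 0" for x y
    using that by (simp add: M simps e1 e3 sym)
  moreover have "B2 (M *v x) (M *v y) = x $ 1 * y $ 1 / (1 / B2 e1 e1) + x $ 2 * y $ 2 / (1 / B2 e2 e2) + x $ 4 * y $ 4"
    if "x $ 3 = 0" "y $ 3 = 0" for x y
    using that by (simp add: M simps e2 e4 sym)
  ultimately show ?thesis using that [of M M' "1 / B2 e1 e1" "1 / B2 e2 e2"] M' in1 in2 by blast
qed

section \<open>The ideal of the edge surface\<close>

lemma P3_zero_mem: "P \<in> P3 \<Longrightarrow> 0 \<in> P"
  unfolding P3_def using vec.subspace_0 by blast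

lemma P3_scale_mem: "P \<in> P3 \<Longrightarrow> x \<in> P \<Longrightarrow> c *s x \<in> P"
  unfolding P3_def using vec.subspace_scale by blast

text \<open>The closure is cut out by the homogeneous polynomials vanishing on \<open>X\<close>. A polynomial vanishing on the
cone over \<open>X\<close> has components with the same property, since the cone is closed under scaling, and so it
vanishes on the closure as well.\<close>

lemma zariski_closure_ideal:
  assumes "X \<subseteq> P3"
  shows "zariski_closed (zariski_closure X)" and "vanishing_ideal (zariski_closure X) = vanishing_ideal X"
proof -
  define S where "S = {f. (\<exists>d. homogeneous4 d f) \<and> (\<forall>P\<in>X. vanishes_at f P)}"
  define Z where "Z = {P \<in> P3. \<forall>f\<in>S. vanishes_at f P}"
  have "X \<subseteq> Z" using assms by (auto simp: Z_def S_def)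
  have closed: "zariski_closed Z" unfolding zariski_closed_def
    by (rule exI [of _ S]) (auto simp: Z_def S_def)
  have closure: "zariski_closure X = Z" unfolding zariski_closure_def
  proof (rule hull_unique [of X Z zariski_closed, OF \<open>X \<subseteq> Z\<close> closed])
    fix T assume "X \<subseteq> T" "zariski_closed T"
    then obtain S' where "\<forall>f\<in>S'. \<exists>d. homogeneous4 d f" "T = {P \<in> P3. \<forall>f\<in>S'. vanishes_at f P}"
      by (auto simp: zariski_closed_def)
    moreover from this have "S' \<subseteq> S" using \<open>X \<subseteq> T\<close> by (auto simp: S_def)
    ultimately show "Z \<subseteq> T" by (auto simp: Z_def)
  qed
  then show "zariski_closed (zariski_closure X)" using closed by simp
  have "vanishes_at f P" if f: "f \<in> vanishing_ideal X" and P: "P \<in> Z" for f P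
  proof -
    have S: "component4 d f \<in> S" for d
    proof -
      have "eval4 (component4 d f) x = 0" if "Q \<in> X" "x \<in> Q" for Q x
      proof -
        have "eval4 f (t *s x) = poly 0 t" for t
          using f that assms P3_scale_mem [of Q x t] by (auto simp: vanishing_ideal_def vanishes_at_def)
        from component4_eq_coeff [OF this] show ?thesis by simp
      qed
      then show ?thesis using homogeneous4_component4 [of d f] unfolding S_def vanishes_at_def by blast
    qed
    show ?thesis unfolding vanishes_at_def
    proof
      fix x assume "x \<in> P"
      obtain n where "\<And>t x. eval4 f (t *s x) = (\<Sum>d<n. t ^ d * eval4 (component4 d f) x)"
        by (rule eval4_component_expansion [of f]) (rule that)
      then have "eval4 f (1 *s x) = (\<Sum>d<n. 1 ^ d * eval4 (component4 d f) x)" .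
      also have "\<dots> = 0" using S P \<open>x \<in> P\<close> by (auto simp: Z_def vanishes_at_def)
      finally show "eval4 f x = 0" by simp
    qed
  qed
  then show "vanishing_ideal (zariski_closure X) = vanishing_ideal X"
    using \<open>X \<subseteq> Z\<close> unfolding closure by (auto simp: vanishing_ideal_def)
qed

lemma stationary_bisecants_P3: "\<Union>(stationary_bisecants C1 C2) \<subseteq> P3"
  by (auto simp: stationary_bisecants_def projective_span_def projectivization_def)

lemma proportional_pair:
  fixes u v p q :: complex
  assumes "u * r1 + v * r2 = 0" "p * r1 + q * r2 = 0" "r1 \<noteq> 0 \<or> r2 \<noteq> 0" "u \<noteq> 0 \<or> v \<noteq> 0"
  obtains k where "p = k * u" "q = k * v"
proof -
  have "r1 * (u * q - v * p) = 0" "r2 * (u * q - v * p) = 0" using assms(1,2) by algebra+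
  then have *: "u * q = v * p" using assms(3) by auto
  show ?thesis
  proof (cases "u = 0")
    case True
    then show ?thesis using that [of "q / v"] * assms(4) by simp
  next
    case False
    then show ?thesis using that [of "p / u"] * by (simp add: field_simps)
  qed
qed

text \<open>In the normal form, a common point of the tangent lines at \<open>p\<close> and \<open>q\<close> is a vector \<open>r\<close> of the line
\<open>x\<^sub>3 = x\<^sub>4 = 0\<close> with \<open>p\<^sub>1 r\<^sub>1 + p\<^sub>2 r\<^sub>2 = 0 = (q\<^sub>1 / a) r\<^sub>1 + (q\<^sub>2 / b) r\<^sub>2\<close>. So \<open>(q\<^sub>1 / a, q\<^sub>2 / b)\<close> is a
multiple of \<open>(p\<^sub>1, p\<^sub>2)\<close>, and rescaling \<open>q\<close> brings the pair of points into the form used in \<open>edge_cone\<close>.\<close>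

lemma stationary_bisecant_ideal:
  assumes C1: "is_conic C1 W1 B1" and C2: "is_conic C2 W2 B2" and disj: "C1 \<inter> C2 = {}"
    and M: "M ** M' = mat 1" "M' ** M = mat 1" and ab: "a \<noteq> 0" "b \<noteq> 0"
    and W1: "\<And>x. M *v x \<in> W1 \<longleftrightarrow> x $ 4 = 0" and W2: "\<And>x. M *v x \<in> W2 \<longleftrightarrow> x $ 3 = 0"
    and B1: "\<And>x y. x $ 4 = 0 \<Longrightarrow> y $ 4 = 0 \<Longrightarrow> B1 (M *v x) (M *v y) = x $ 1 * y $ 1 + x $ 2 * y $ 2 + x $ 3 * y $ 3"
    and B2: "\<And>x y. x $ 3 = 0 \<Longrightarrow> y $ 3 = 0 \<Longrightarrow> B2 (M *v x) (M *v y) = x $ 1 * y $ 1 / a + x $ 2 * y $ 2 / b + x $ 4 * y $ 4"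
  shows "f \<in> vanishing_ideal (\<Union>(stationary_bisecants C1 C2)) \<longleftrightarrow> (\<forall>x\<in>edge_cone a b. eval4 f (M *v x) = 0)"
proof
  have inv: "M *v (M' *v x) = x" "M' *v (M *v x) = x" for x
    using M by (simp_all add: matrix_vector_mul_assoc)
  have nz: "M *v x = 0 \<longleftrightarrow> x = 0" for x using inv(2) [of x] by (metis matrix_vector_mult_0_right)
  {
    assume f: "f \<in> vanishing_ideal (\<Union>(stationary_bisecants C1 C2))"
    show "\<forall>x\<in>edge_cone a b. eval4 f (M *v x) = 0"
    proof
      fix x assume "x \<in> edge_cone a b"
      then obtain s t u v z w where uv: "u^2 + v^2 + z^2 = 0" "a * u^2 + b * v^2 + w^2 = 0" "u \<noteq> 0 \<or> v \<noteq> 0"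
        and x: "x = vector [(s + t * a) * u, (s + t * b) * v, s * z, t * w]"
        by (auto simp: edge_cone_def)
      define p where "p = M *v vector [u, v, z, 0]"
      define q where "q = M *v vector [a * u, b * v, 0, w]"
      define r where "r = M *v vector [- v, u, 0, 0]"
      have "vector [u, v, z, 0] \<noteq> (0 :: complex^4)" "vector [a * u, b * v, 0, w] \<noteq> (0 :: complex^4)"
        "vector [- v, u, 0, 0] \<noteq> (0 :: complex^4)"
        using uv ab by (auto simp: vec_eq_iff forall_4)
      then have nonzero: "p \<noteq> 0" "q \<noteq> 0" "r \<noteq> 0" by (simp_all add: p_def q_def r_def nz)
      have p: "p \<in> W1" "p \<noteq> 0" "B1 p p = 0"
        using uv nonzero by (simp_all add: p_def W1 B1 power2_eq_square)
      have "B2 q q = a * u^2 + b * v^2 + w^2" using ab by (simp add: q_def B2 power2_eq_square)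
      then have q: "q \<in> W2" "q \<noteq> 0" "B2 q q = 0"
        using uv nonzero by (simp_all add: q_def W2)
      have r: "r \<in> W1" "r \<in> W2" "r \<noteq> 0" "B1 p r = 0" "B2 q r = 0"
        using nonzero ab by (simp_all add: p_def q_def r_def W1 W2 B1 B2)
      let ?P = "vec.span {p}" and ?Q = "vec.span {q}"
      have PQ: "?P \<in> C1" "?Q \<in> C2" using conic_memI [OF C1 p] conic_memI [OF C2 q] by auto
      have meet: "vec.span {r} \<in> tangent_line C1 ?P \<inter> tangent_line C2 ?Q"
      proof -
        have "vec.span {r} \<subseteq> {v \<in> W1. B1 p v = 0}" "vec.span {r} \<subseteq> {v \<in> W2. B2 q v = 0}"
          using r C1 C2 unfolding is_conic_def
          by (auto simp: span_singleton_iff symmetric_bilinear_simps intro: vec.subspace_scale)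
        moreover have "vec.span {r} \<in> P3" using r(3) P3_iff by blast
        ultimately show ?thesis unfolding conic_tangent_line [OF C1 p] conic_tangent_line [OF C2 q]
          by (auto simp: projectivization_def)
      qed
      have "?P \<noteq> ?Q" using PQ disj by auto
      then have line: "projective_span {?P, ?Q} \<in> stationary_bisecants C1 C2"
        unfolding stationary_bisecants_def using PQ meet by blast
      have Mx: "M *v x = s *s p + t *s q"
      proof -
        have "x = s *s vector [u, v, z, 0] + t *s vector [a * u, b * v, 0, w]"
          by (simp add: x vec_eq_iff forall_4 algebra_simps)
        then show ?thesis by (simp add: p_def q_def matrix_vector_right_distrib vector_scalar_commute)
      qed
      have "M *v x \<in> vec.span (\<Union>{?P, ?Q})"
        unfolding Mx by (intro vec.span_add vec.span_scale vec.span_base) (auto intro: vec.span_base)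
      then have sub: "vec.span {M *v x} \<subseteq> vec.span (\<Union>{?P, ?Q})"
        by (intro vec.span_minimal) auto
      have mem: "R \<subseteq> vec.span (\<Union>{?P, ?Q}) \<Longrightarrow> R \<in> P3 \<Longrightarrow> y \<in> R \<Longrightarrow> eval4 f y = 0" for R y
        using f line unfolding vanishing_ideal_def vanishes_at_def projective_span_def projectivization_def by blast
      show "eval4 f (M *v x) = 0"
      proof (cases "M *v x = 0")
        case True
        have "?P \<in> P3" using p P3_iff by blast
        then show ?thesis using mem [of ?P 0] True vec.span_base [of _ "\<Union>{?P, ?Q}"] P3_zero_mem by auto
      next
        case False
        then have "vec.span {M *v x} \<in> P3" using P3_iff by blast
        then show ?thesis using mem [OF sub] vec.span_base by blast
      qed
    qed
  }
  {
    assume f: "\<forall>x\<in>edge_cone a b. eval4 f (M *v x) = 0"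
    have "eval4 f y = 0"
      if P: "P \<in> C1" and Q: "Q \<in> C2" and meet: "tangent_line C1 P \<inter> tangent_line C2 Q \<noteq> {}"
        and y: "y \<in> vec.span (\<Union>{P, Q})" for P Q y
    proof -
      obtain p where p: "P = vec.span {p}" "p \<in> W1" "p \<noteq> 0" "B1 p p = 0"
        by (rule conic_memD [OF C1 P]) (rule that)
      obtain q where q: "Q = vec.span {q}" "q \<in> W2" "q \<noteq> 0" "B2 q q = 0"
        by (rule conic_memD [OF C2 Q]) (rule that)
      obtain R where R: "R \<in> P3" "R \<subseteq> {v \<in> W1. B1 p v = 0}" "R \<subseteq> {v \<in> W2. B2 q v = 0}"
        using meet unfolding p(1) q(1) conic_tangent_line [OF C1 p(2-4)] conic_tangent_line [OF C2 q(2-4)]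
        by (auto simp: projectivization_def)
      then obtain r where "r \<noteq> 0" "R = vec.span {r}" using P3_iff by blast
      then have r: "r \<noteq> 0" "r \<in> W1" "r \<in> W2" "B1 p r = 0" "B2 q r = 0"
        using R vec.span_base [of r "{r}"] by auto
      define p' where "p' = M' *v p"
      define q' where "q' = M' *v q"
      define r' where "r' = M' *v r"
      have Mp: "p = M *v p'" "q = M *v q'" "r = M *v r'" by (simp_all add: p'_def q'_def r'_def inv)
      have p': "p' $ 4 = 0" "p' \<noteq> 0" and q': "q' $ 3 = 0" "q' \<noteq> 0"
        and r': "r' $ 3 = 0" "r' $ 4 = 0" "r' \<noteq> 0"
        using p q r unfolding Mp W1 W2 nz by auto
      have eqs: "(p' $ 1)^2 + (p' $ 2)^2 + (p' $ 3)^2 = 0"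
        "(q' $ 1)^2 / a + (q' $ 2)^2 / b + (q' $ 4)^2 = 0"
        "p' $ 1 * r' $ 1 + p' $ 2 * r' $ 2 = 0"
        "q' $ 1 / a * r' $ 1 + q' $ 2 / b * r' $ 2 = 0"
        using p(4) q(4) r(4,5) p' q' r' unfolding Mp by (simp_all add: B1 B2 power2_eq_square)
      have "r' $ 1 \<noteq> 0 \<or> r' $ 2 \<noteq> 0" using r' by (auto simp: vec_eq_iff forall_4)
      moreover have p12: "p' $ 1 \<noteq> 0 \<or> p' $ 2 \<noteq> 0" using p' eqs(1) by (auto simp: vec_eq_iff forall_4)
      ultimately obtain k where "q' $ 1 / a = k * p' $ 1" "q' $ 2 / b = k * p' $ 2"
        using proportional_pair [OF eqs(3,4)] by metis
      then have k: "q' $ 1 = k * a * p' $ 1" "q' $ 2 = k * b * p' $ 2" using ab by (auto simp: field_simps)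
      have "k \<noteq> 0"
      proof
        assume "k = 0"
        then have "q' = 0" using k eqs(2) q' by (auto simp: vec_eq_iff forall_4)
        then show False using q' by blast
      qed
      \<comment> \<open>The parameters of the point are \<open>p'\<close>, \<open>w\<close>, \<open>s\<close> and \<open>t * k\<close>.\<close>
      define w where "w = q' $ 4 / k"
      have "k^2 * (a * (p' $ 1)^2 + b * (p' $ 2)^2 + w^2) = (q' $ 1)^2 / a + (q' $ 2)^2 / b + (q' $ 4)^2"
        using \<open>k \<noteq> 0\<close> ab by (simp add: k w_def power2_eq_square algebra_simps)
      then have w: "a * (p' $ 1)^2 + b * (p' $ 2)^2 + w^2 = 0" using eqs(2) \<open>k \<noteq> 0\<close> by simp
      have "y \<in> vec.span (vec.span {p} \<union> vec.span {q})" using y p(1) q(1) by simp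
      then obtain s t where y: "y = s *s p + t *s q"
        unfolding vec.span_Un vec.span_span by (auto simp: span_singleton_iff)
      let ?x = "vector [(s + t * k * a) * p' $ 1, (s + t * k * b) * p' $ 2, s * p' $ 3, t * k * w] :: complex^4"
      have "?x \<in> edge_cone a b" unfolding edge_cone_def using eqs(1) w p12 by blast
      moreover have "s *s p' + t *s q' = ?x"
        using p' q' \<open>k \<noteq> 0\<close> by (simp add: vec_eq_iff forall_4 k w_def algebra_simps)
      then have "y = M *v ?x"
        unfolding y Mp by (simp add: matrix_vector_right_distrib vector_scalar_commute flip: \<open>s *s p' + t *s q' = ?x\<close>)
      ultimately show ?thesis using f by simp
    qed
    then show "f \<in> vanishing_ideal (\<Union>(stationary_bisecants C1 C2))"
      unfolding vanishing_ideal_def vanishes_at_def stationary_bisecants_def projective_span_def projectivization_def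
      by blast
  }
qed

theorem theorem3p5:
  fixes C1 C2 H1 H2 :: "point set"
  assumes "smooth_conic C1" and "smooth_conic C2"
    and "H1 = projective_span C1" and "H2 = projective_span C2"
    and "H1 \<noteq> H2"
    and "C1 \<inter> C2 = {}"
    and "\<not> tangent_to_plane C1 H2" and "\<not> tangent_to_plane C2 H1"
  shows "surface_of_degree 8 (edge_surface C1 C2)"
proof -
  obtain W1 B1 where C1: "is_conic C1 W1 B1" by (rule smooth_conic_is_conic [OF assms(1)]) (rule that)
  obtain W2 B2 where C2: "is_conic C2 W2 B2" by (rule smooth_conic_is_conic [OF assms(2)]) (rule that)
  have H: "H1 = projectivization W1" "H2 = projectivization W2"
    using assms(3,4) projective_span_conic C1 C2 by auto
  then have "W1 \<noteq> W2" using assms(5) by auto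
  obtain M M' :: "complex^4^4" and a b where M: "M ** M' = mat 1" "M' ** M = mat 1"
    and ab: "a \<noteq> 0" "b \<noteq> 0" "a \<noteq> b"
    and W: "\<And>x. M *v x \<in> W1 \<longleftrightarrow> x $ 4 = 0" "\<And>x. M *v x \<in> W2 \<longleftrightarrow> x $ 3 = 0"
    and B1: "\<And>x y. x $ 4 = 0 \<Longrightarrow> y $ 4 = 0 \<Longrightarrow> B1 (M *v x) (M *v y) = x $ 1 * y $ 1 + x $ 2 * y $ 2 + x $ 3 * y $ 3"
    and B2: "\<And>x y. x $ 3 = 0 \<Longrightarrow> y $ 3 = 0 \<Longrightarrow> B2 (M *v x) (M *v y) = x $ 1 * y $ 1 / a + x $ 2 * y $ 2 / b + x $ 4 * y $ 4"
    by (rule conic_pair_normal_form [OF C1 C2 \<open>W1 \<noteq> W2\<close> assms(6) assms(7) [unfolded H] assms(8) [unfolded H]])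
      (rule that)
  have inv: "M *v (M' *v x) = x" "M' *v (M *v x) = x" for x
    using M by (simp_all add: matrix_vector_mul_assoc)
  obtain F where "(\<lambda>y. edge_form a b (M' *v y)) = eval4 F"
    using polyfun_linear_subst [OF polyfun_edge_form] by (rule polyfunE)
  then have F: "eval4 F y = edge_form a b (M' *v y)" for y by metis
  have "homogeneous4 8 F"
    unfolding homogeneous4_iff F by (simp add: vector_scalar_commute edge_form_homogeneous)
  moreover have "F \<noteq> 0"
  proof
    assume "F = 0"
    then have "edge_form a b (M' *v (M *v axis 1 1)) = 0" using F by (metis eval4_zero)
    moreover have "edge_form a b (axis 1 1) = b^2"
      by (simp add: edge_form_def cubic_discriminant_def axis_def)
    ultimately show False using ab inv by simp
  qed
  moreover have "vanishing_ideal (edge_surface C1 C2) = {G. F dvd G}"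
  proof -
    have iff: "G \<in> vanishing_ideal (edge_surface C1 C2) \<longleftrightarrow> (\<forall>x\<in>edge_cone a b. eval4 G (M *v x) = 0)" for G
      unfolding edge_surface_def zariski_closure_ideal(2) [OF stationary_bisecants_P3]
      by (rule stationary_bisecant_ideal [OF C1 C2 assms(6) M ab(1,2) W B1 B2])
    have dvd: "F dvd G" if G: "\<forall>x\<in>edge_cone a b. eval4 G (M *v x) = 0" for G
    proof -
      obtain Q where Q: "polyfun Q" "\<And>x. eval4 G (M *v x) = edge_form a b x * Q x"
        using edge_form_divides [OF ab polyfun_linear_subst [OF polyfun_eval4, of G M]] G by metis
      have "eval4 G x = eval4 F x * Q (M' *v x)" for x
        using Q(2) [of "M' *v x"] by (simp add: F inv)
      then show ?thesis unfolding dvd_iff_polyfun using polyfun_linear_subst [OF Q(1)] by blast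
    qed
    have vanish: "eval4 G (M *v x) = 0" if "F dvd G" "x \<in> edge_cone a b" for G x
      using that edge_form_vanishes by (auto elim!: dvdE simp: F inv)
    show ?thesis
    proof (rule set_eqI)
      show "G \<in> vanishing_ideal (edge_surface C1 C2) \<longleftrightarrow> G \<in> {G. F dvd G}" for G
        unfolding iff mem_Collect_eq using dvd [of G] vanish [of G] by blast
    qed
  qed
  ultimately show ?thesis
    unfolding surface_of_degree_def edge_surface_def
    using zariski_closure_ideal(1) [OF stationary_bisecants_P3] by (auto simp: edge_surface_def)
qed

end
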